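(* Let $c,D>0$ be such that the cubic $\Delta_0(\lambda)=c\lambda^3+D\lambda^2-c\lambda+1$ has two distinct positive real roots. Then, for every sufficiently small $r\ge 0$, the pair $(\underline\phi,\overline\phi)$ of the context (for suitable parameters $\varepsilon>0$, $q>0$, $\xi_1<0$) is an ordered sub/super pair for $$c\,\phi'''(\xi)+D\,\phi''(\xi)-c\,\phi'(\xi)+\phi(\xi-r)\bigl(1-\phi(\xi)\bigr)=0,\qquad \xi\in\mathbb{R},\tag{E}$$ that is, $\overline\phi$ satisfies (E) with $=0$ replaced by $\le 0$ and $\underline\phi$ satisfies (E) with $=0$ replaced by $\ge0$ (away from their finitely many break points), and $$0\le\underline\phi(\xi)\le\overline\phi(\xi),\qquad \xi\in\mathbb{R};$$ and consequently there exists a monotone traveling wave solution of (E), i.e. a nondecreasing solution $\phi$ of (E) with $\lim_{\xi\to-\infty}\phi(\xi)=0$ and $\lim_{\xi\to+\infty}\phi(\xi)=1$.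
   Context: Equation (E) is the profile equation, with $r=c\tau$, for traveling waves $u(x,t)=\phi(x+ct)$ of $u_t=Du_{xx}+u_{xxt}+u(x,t-\tau)(1-u(x,t))$. Put $\Delta_r(\lambda)=c\lambda^3+D\lambda^2-c\lambda+e^{-\lambda r}$. For small $r\ge0$ the function $\Delta_r$ has two distinct positive real roots near those of $\Delta_0$; let $\eta_1$ be the smallest positive root of $\Delta_r$ and $\eta_2$ the next one. Here $\varepsilon>0$ is small with $\eta_1+\varepsilon<\eta_2$. Define $$\overline\phi(\xi)=\begin{cases}\tfrac12e^{\eta_1\xi},&\xi<0,\\ 1-\tfrac12e^{-\eta_1\xi},&\xi\ge0,\end{cases}\qquad \underline\phi(\xi)=\begin{cases}\tfrac12(1-qe^{\varepsilon\xi})e^{\eta_1\xi},&\xi<\xi_1,\\ d_1:=\tfrac12(1-qe^{\varepsilon\xi_1})e^{\eta_1\xi_1},&\xi\ge\xi_1,\end{cases}$$ where $q>0$ and $\xi_1<0$ are chosen with $0<d_1<1$ and $\underline\phi$ of class $C^1$. *)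

theory Defs
  imports "HOL-Analysis.Analysis"
begin

definition char_fun :: "real \<Rightarrow> real \<Rightarrow> real \<Rightarrow> real \<Rightarrow> real"
  where "char_fun c D r l = c * l^3 + D * l^2 - c * l + exp (- (l * r))"

(* With a = 0 this says that b is the smallest positive root of f. *)
definition next_root_after :: "(real \<Rightarrow> real) \<Rightarrow> real \<Rightarrow> real \<Rightarrow> bool"
  where "next_root_after f a b \<longleftrightarrow>
    a < b \<and> f b = 0 \<and> (\<forall>x. a < x \<and> x < b \<longrightarrow> f x \<noteq> 0)"

definition super_profile :: "real \<Rightarrow> real \<Rightarrow> real"
  where "super_profile \<eta>1 \<xi> =
    (if \<xi> < 0 then 1/2 * exp (\<eta>1 * \<xi>) else 1 - 1/2 * exp (- (\<eta>1 * \<xi>)))"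

definition sub_level :: "real \<Rightarrow> real \<Rightarrow> real \<Rightarrow> real \<Rightarrow> real"
  where "sub_level \<eta>1 \<epsilon> q \<xi>1 = 1/2 * (1 - q * exp (\<epsilon> * \<xi>1)) * exp (\<eta>1 * \<xi>1)"

definition sub_profile :: "real \<Rightarrow> real \<Rightarrow> real \<Rightarrow> real \<Rightarrow> real \<Rightarrow> real"
  where "sub_profile \<eta>1 \<epsilon> q \<xi>1 \<xi> =
    (if \<xi> < \<xi>1 then 1/2 * (1 - q * exp (\<epsilon> * \<xi>)) * exp (\<eta>1 * \<xi>)
     else sub_level \<eta>1 \<epsilon> q \<xi>1)"

(* Meant for open S, where deriv is the true derivative at every point of S
   as soon as the function is differentiable there. *)
definition thrice_differentiable_on :: "(real \<Rightarrow> real) \<Rightarrow> real set \<Rightarrow> bool"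
  where "thrice_differentiable_on \<phi> S \<longleftrightarrow>
    (\<forall>k<3. \<forall>\<xi>\<in>S. (deriv ^^ k) \<phi> differentiable (at \<xi>))"

(* Left-hand side of the profile equation
   c phi''' + D phi'' - c phi' + phi(xi - r) (1 - phi(xi)) = 0. *)
definition profile_lhs :: "real \<Rightarrow> real \<Rightarrow> real \<Rightarrow> (real \<Rightarrow> real) \<Rightarrow> real \<Rightarrow> real"
  where "profile_lhs c D r \<phi> \<xi> =
    c * (deriv ^^ 3) \<phi> \<xi> + D * (deriv ^^ 2) \<phi> \<xi> - c * deriv \<phi> \<xi> + \<phi> (\<xi> - r) * (1 - \<phi> \<xi>)"

(* B is the set of break points; only there may the differential inequality,
   and the differentiability it presupposes, fail. *)
definition supersolution_off ::
    "real \<Rightarrow> real \<Rightarrow> real \<Rightarrow> real set \<Rightarrow> (real \<Rightarrow> real) \<Rightarrow> bool"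
  where "supersolution_off c D r B \<phi> \<longleftrightarrow>
    finite B \<and> thrice_differentiable_on \<phi> (- B) \<and> (\<forall>\<xi>\<in>- B. profile_lhs c D r \<phi> \<xi> \<le> 0)"

definition subsolution_off ::
    "real \<Rightarrow> real \<Rightarrow> real \<Rightarrow> real set \<Rightarrow> (real \<Rightarrow> real) \<Rightarrow> bool"
  where "subsolution_off c D r B \<phi> \<longleftrightarrow>
    finite B \<and> thrice_differentiable_on \<phi> (- B) \<and> (\<forall>\<xi>\<in>- B. profile_lhs c D r \<phi> \<xi> \<ge> 0)"

definition profile_solution :: "real \<Rightarrow> real \<Rightarrow> real \<Rightarrow> (real \<Rightarrow> real) \<Rightarrow> bool"
  where "profile_solution c D r \<phi> \<longleftrightarrow>
    thrice_differentiable_on \<phi> UNIV \<and> (\<forall>\<xi>. profile_lhs c D r \<phi> \<xi> = 0)"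

definition monotone_wave :: "real \<Rightarrow> real \<Rightarrow> real \<Rightarrow> (real \<Rightarrow> real) \<Rightarrow> bool"
  where "monotone_wave c D r \<phi> \<longleftrightarrow>
    profile_solution c D r \<phi> \<and> mono \<phi> \<and>
    (\<phi> \<longlongrightarrow> 0) at_bot \<and> (\<phi> \<longlongrightarrow> 1) at_top"

end

theory Submission
  imports Defs "HOL-Probability.Distributions"
begin

text \<open>
  Write (E) as $L\phi = H\phi$ with $L\phi = -c\phi''' - D\phi'' + c\phi' + \phi$ and
  $H\phi(\xi) = \phi(\xi - r)(1 - \phi(\xi)) + \phi(\xi)$; the added term makes $H$ monotone on
  functions with values in $[0,1]$. A positive root $l$ of $\Delta_0$ gives $1 - cl^3 - Dl^2 + cl = 2$
  and, at $-l$, the value $-2Dl^2 < 0$, so the symbol of $L$ has roots $\mu > 0$ and $-a, -b < 0$, all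
  distinct. Hence $L = c(\mu - \partial)(\partial + a)(\partial + b)$ with $c\mu ab = 1$, and $L^{-1}$ is
  the composition of three averages over exponentially distributed shifts, a positive
  translation-invariant operator. The map $L^{-1}H$ therefore preserves order and monotonicity of
  functions. Its action on exponentials is explicit, so $\min(1, e^{\eta_1\xi})$ and
  $\max(0, e^{\eta_1\xi} - qe^{(\eta_1+\varepsilon)\xi})$ are an upper and a lower bound for the iteration;
  these replace the pair of the statement because $L^{-1}$ then never has to be applied across a
  break point. The limit is a fixed point, and its limit $\ell > 0$ at $+\infty$ satisfies
  $\ell = \ell(1 - \ell) + \ell$, so $\ell = 1$. Smallness of $r$ is needed only for the explicit
  supersolution on $\xi \ge 0$.
\<close>

section \<open>Averages over exponentially distributed shifts\<close>

text \<open>For \<open>\<sigma>\<close> equal to 1 or -1 and \<open>f\<close> in the class below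
  this is the bounded solution \<open>u\<close> of \<open>u' = \<sigma> * a * (u - f)\<close>, hence
  the resolvent of a first-order operator; the form as an expectation makes positivity and total
  mass 1 immediate.\<close>

definition exp_avg :: "real \<Rightarrow> real \<Rightarrow> (real \<Rightarrow> real) \<Rightarrow> real \<Rightarrow> real"
  where "exp_avg a \<sigma> f x = (LINT s|density lborel (exponential_density a). f (x + \<sigma> * s))"

definition unit_cont :: "(real \<Rightarrow> real) \<Rightarrow> bool"
  where "unit_cont f \<longleftrightarrow> continuous_on UNIV f \<and> (\<forall>x. 0 \<le> f x \<and> f x \<le> 1)"

lemma unit_contD:
  assumes "unit_cont f"
  shows "continuous_on UNIV f" "isCont f x" "0 \<le> f x" "f x \<le> 1" "\<bar>f x\<bar> \<le> 1"
    "f \<in> borel_measurable borel"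
  using assms unfolding unit_cont_def
  by (auto simp: continuous_on_eq_continuous_at intro: borel_measurable_continuous_onI)

lemma mono_bounded_tendsto_at_top:
  fixes f :: "real \<Rightarrow> real"
  assumes "mono f" and "\<And>x. f x \<le> B"
  shows "(f \<longlongrightarrow> (SUP x. f x)) at_top"
proof (rule increasing_tendsto)
  have bdd: "bdd_above (range f)"
    using assms(2) by (auto intro: bdd_aboveI[where M=B])
  show "eventually (\<lambda>x. f x \<le> (SUP x. f x)) at_top"
    using cSUP_upper[OF _ bdd] by auto
  fix y assume "y < (SUP x. f x)"
  then obtain z where "y < f z"
    using less_cSUP_iff[OF _ bdd] by auto
  then show "eventually (\<lambda>x. y < f x) at_top"
    using assms(1) by (intro eventually_at_top_linorderI[of z]) (meson less_le_trans monoD)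
qed

lemma integrable_exp_avg:
  assumes "a > 0" and [measurable]: "f \<in> borel_measurable borel" and "\<And>x. \<bar>f x\<bar> \<le> (B :: real)"
  shows "integrable (density lborel (exponential_density a)) (\<lambda>s. f (x + \<sigma> * s))"
proof -
  interpret prob_space "density lborel (exponential_density a)"
    using assms(1) by (rule prob_space_exponential_density)
  show ?thesis
    using assms(3) by (intro integrable_const_bound[where B=B]) auto
qed

lemma exp_avg_mono:
  assumes "a > 0" "unit_cont f" "unit_cont g" and "\<And>x. f x \<le> g x"
  shows "exp_avg a \<sigma> f x \<le> exp_avg a \<sigma> g x"
  unfolding exp_avg_def using assms
  by (intro integral_mono integrable_exp_avg[where B=1] unit_contD) auto

lemma mono_exp_avg:
  assumes "a > 0" "unit_cont f" and "mono f"
  shows "mono (exp_avg a \<sigma> f)"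
  unfolding exp_avg_def using assms
  by (intro monoI integral_mono integrable_exp_avg[where B=1] unit_contD) (auto intro: monoD)

lemma exp_avg_bounds:
  assumes "a > 0" "unit_cont f"
  shows "0 \<le> exp_avg a \<sigma> f x" "exp_avg a \<sigma> f x \<le> 1"
proof -
  interpret prob_space "density lborel (exponential_density a)"
    using assms(1) by (rule prob_space_exponential_density)
  show "0 \<le> exp_avg a \<sigma> f x"
    unfolding exp_avg_def using unit_contD[OF assms(2)] by (intro integral_nonneg_AE) auto
  show "exp_avg a \<sigma> f x \<le> 1"
    unfolding exp_avg_def using assms unit_contD[OF assms(2)]
    by (intro integral_le_const integrable_exp_avg[where B=1]) auto
qed

text \<open>Exponential tilting: the density of rate \<open>a\<close> times
  \<open>exp (\<sigma> * l * s)\<close> is \<open>a / k\<close> times the density of rate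
  \<open>k = a - \<sigma> * l\<close>. So exponentials are eigenfunctions of the average.\<close>

lemma exp_avg_exp:
  assumes "a > 0" "\<sigma> * l < a"
  shows "has_bochner_integral (density lborel (exponential_density a))
    (\<lambda>s. exp (l * (x + \<sigma> * s))) (a / (a - \<sigma> * l) * exp (l * x))"
proof -
  define k where "k = a - \<sigma> * l"
  have k: "k > 0" using assms k_def by simp
  have "has_bochner_integral lborel (\<lambda>s. a / k * exp (l * x) * exponential_density k s)
     (a / k * exp (l * x) * 1)"
  proof (intro has_bochner_integral_mult_right)
    interpret prob_space "density lborel (exponential_density k)"
      using k by (rule prob_space_exponential_density)
    have "has_bochner_integral (density lborel (exponential_density k)) (\<lambda>s. 1 :: real) 1"
      using prob_space by (simp add: has_bochner_integral_iff)
    then show "has_bochner_integral lborel (exponential_density k) 1"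
      using k integrable_density[of "\<lambda>_. 1 :: real" lborel "exponential_density k"]
        integral_density[of "\<lambda>_. 1 :: real" lborel "exponential_density k"]
      by (simp add: exponential_density_nonneg has_bochner_integral_iff)
  qed
  moreover have "a / k * exp (l * x) * exponential_density k s
      = exponential_density a s *\<^sub>R exp (l * (x + \<sigma> * s))" for s
    using k by (auto simp: exponential_density_def k_def field_simps simp flip: exp_add)
  ultimately show ?thesis
    using assms(1) k_def
    by (intro has_bochner_integral_density) (auto simp: exponential_density_nonneg)
qed

lemma exp_avg_le_exp:
  assumes a: "a > 0" and f: "f \<in> borel_measurable borel" "\<And>x. \<bar>f x\<bar> \<le> 1"
    and l: "\<sigma> * l < a" "\<sigma> * k < a"
    and le: "\<And>x. f x \<le> A * exp (l * x) + B * exp (k * x)"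
  shows "exp_avg a \<sigma> f x
    \<le> (A * (a / (a - \<sigma> * l))) * exp (l * x) + (B * (a / (a - \<sigma> * k))) * exp (k * x)"
proof -
  let ?M = "density lborel (exponential_density a)"
  have *: "has_bochner_integral ?M
      (\<lambda>s. A * exp (l * (x + \<sigma> * s)) + B * exp (k * (x + \<sigma> * s)))
      (A * (a / (a - \<sigma> * l) * exp (l * x)) + B * (a / (a - \<sigma> * k) * exp (k * x)))"
    using a l by (intro has_bochner_integral_add has_bochner_integral_mult_right exp_avg_exp)
  have "exp_avg a \<sigma> f x
      \<le> (LINT s|?M. A * exp (l * (x + \<sigma> * s)) + B * exp (k * (x + \<sigma> * s)))"
    unfolding exp_avg_def
    using integrable_exp_avg[OF a f] has_bochner_integral_iff[THEN iffD1, OF *] le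
    by (intro integral_mono) auto
  also have "\<dots> = (A * (a / (a - \<sigma> * l))) * exp (l * x) + (B * (a / (a - \<sigma> * k))) * exp (k * x)"
    using * by (simp add: has_bochner_integral_iff)
  finally show ?thesis .
qed

lemma exp_avg_ge_exp:
  assumes a: "a > 0" and f: "f \<in> borel_measurable borel" "\<And>x. \<bar>f x\<bar> \<le> 1"
    and l: "\<sigma> * l < a" "\<sigma> * k < a"
    and le: "\<And>x. A * exp (l * x) + B * exp (k * x) \<le> f x"
  shows "(A * (a / (a - \<sigma> * l))) * exp (l * x) + (B * (a / (a - \<sigma> * k))) * exp (k * x)
    \<le> exp_avg a \<sigma> f x"
proof -
  have "- f y \<le> - A * exp (l * y) + - B * exp (k * y)" for y
    using le[of y] by simp
  from exp_avg_le_exp[OF a _ _ l this, of x] f show ?thesis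
    by (simp add: exp_avg_def)
qed

lemma exp_avg_tendsto:
  assumes a: "a > 0" and g: "\<And>n. unit_cont (g n)" and f: "f \<in> borel_measurable borel"
    and lim: "\<And>x. (\<lambda>n. g n x) \<longlonglongrightarrow> f x"
  shows "(\<lambda>n. exp_avg a \<sigma> (g n) x) \<longlonglongrightarrow> exp_avg a \<sigma> f x"
proof -
  interpret prob_space "density lborel (exponential_density a)"
    using assms(1) by (rule prob_space_exponential_density)
  note [measurable] = f unit_contD(6)[OF g]
  show ?thesis
    unfolding exp_avg_def using lim unit_contD(5)[OF g]
    by (intro integral_dominated_convergence[where w="\<lambda>_. 1"]) auto
qed

lemma exp_avg_tendsto_at_top:
  assumes a: "a > 0" and f: "unit_cont f" and lim: "(f \<longlongrightarrow> L) at_top"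
  shows "(exp_avg a \<sigma> f \<longlongrightarrow> L) at_top"
proof -
  interpret prob_space "density lborel (exponential_density a)"
    using assms(1) by (rule prob_space_exponential_density)
  note [measurable] = unit_contD(6)[OF f]
  have *: "((\<lambda>x. f (x + \<sigma> * s)) \<longlongrightarrow> L) at_top" for s
    by (rule filterlim_compose[OF lim])
      (use filterlim_tendsto_add_at_top[OF tendsto_const[of "\<sigma> * s"] filterlim_ident] in
        \<open>simp add: add.commute\<close>)
  have "((\<lambda>x. LINT s|density lborel (exponential_density a). f (x + \<sigma> * s)) \<longlongrightarrow>
      (LINT s|density lborel (exponential_density a). L)) at_top"
    using * unit_contD(5)[OF f]
    by (intro integral_dominated_convergence_at_top[where w="\<lambda>_. 1"]) auto
  then show ?thesis
    using prob_space by (simp add: exp_avg_def[abs_def])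
qed

text \<open>Substitution turns the average into \<open>exp (a * x) * (L - G x)\<close>, where
  \<open>G\<close> is an antiderivative of \<open>h\<close> and \<open>L\<close> its limit at
  infinity; the product rule does the rest.\<close>

lemma exp_avg_right_deriv:
  assumes a: "a > 0" and f: "unit_cont f"
  shows "(exp_avg a 1 f has_real_derivative a * (exp_avg a 1 f x - f x)) (at x)"
proof -
  define h where "h t = a * exp (- (a * t)) * f t" for t
  have "isCont h t" for t
    unfolding h_def using unit_contD(2)[OF f] by (intro continuous_intros)
  then obtain G where "\<And>t. (G has_vector_derivative h t) (at t)"
    using einterval_antiderivative[of "-\<infinity>" "\<infinity>" h] by auto
  then have G: "(G has_real_derivative h t) (at t)" for t
    by (simp add: has_real_derivative_iff_has_vector_derivative)
  have h0: "0 \<le> h t" for t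
    using a unit_contD(3)[OF f] by (simp add: h_def)
  have "mono G"
    using G h0 by (intro monoI) (rule DERIV_nonneg_imp_nondecreasing, auto)
  moreover have "G t \<le> G 0 + 1" for t
  proof (cases "t \<le> 0")
    case True
    then show ?thesis using \<open>mono G\<close>[THEN monoD, of t 0] by simp
  next
    case False
    \<comment> \<open>As \<open>f \<le> 1\<close>, \<open>h\<close> is at most minus the derivative
      of \<open>exp (- (a * t))\<close>. The resulting bound on \<open>G\<close> is what makes
      \<open>L\<close> exist.\<close>
    have "G t + exp (- (a * t)) \<le> G 0 + exp (- (a * 0))"
    proof (rule DERIV_nonpos_imp_nonincreasing[where f="\<lambda>t. G t + exp (- (a * t))"])
      show "\<exists>y. ((\<lambda>t. G t + exp (- (a * t))) has_real_derivative y) (at s) \<and> y \<le> 0" for s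
        using a unit_contD(4)[OF f, of s]
        by (intro exI[of _ "h s + exp (- (a * s)) * (- a)"] conjI)
          (auto intro!: derivative_eq_intros G simp: h_def mult_left_le algebra_simps)
    qed (use False in auto)
    then have "G t + exp (- (a * t)) \<le> G 0 + 1" by simp
    with exp_ge_zero[of "- (a * t)"] show ?thesis by linarith
  qed
  ultimately obtain L where L: "(G \<longlongrightarrow> L) at_top"
    using mono_bounded_tendsto_at_top by blast
  have eq: "exp_avg a 1 f = (\<lambda>x. exp (a * x) * (L - G x))"
  proof
    fix x
    let ?g = "\<lambda>s. exp (a * x) * h (x + s)"
    have [measurable]: "f \<in> borel_measurable borel"
      using unit_contD[OF f] by auto
    have nn: "(\<integral>\<^sup>+s. ennreal (?g s) * indicator {0 ..} s \<partial>lborel)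
        = exp (a * x) * L - exp (a * x) * G (x + 0)"
    proof (rule nn_integral_FTC_atLeast[where F="\<lambda>s. exp (a * x) * G (x + s)"])
      show "?g \<in> borel_measurable borel" unfolding h_def by measurable
      show "((\<lambda>s. exp (a * x) * G (x + s)) has_real_derivative ?g s) (at s)" for s
        using G[of "x + s"] by (intro DERIV_cmult) (simp add: add.commute flip: DERIV_shift)
      show "((\<lambda>s. exp (a * x) * G (x + s)) \<longlongrightarrow> exp (a * x) * L) at_top"
        by (intro tendsto_intros filterlim_compose[OF L] filterlim_tendsto_add_at_top[OF tendsto_const] filterlim_ident)
    qed (use h0 in auto)
    have "G x \<le> L"
      using \<open>mono G\<close> L by (intro tendsto_lowerbound[OF L])
        (auto simp: eventually_at_top_linorder intro: monoD)
    then have pos: "0 \<le> exp (a * x) * L - exp (a * x) * G (x + 0)"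
      by (simp flip: right_diff_distrib)
    have density: "exponential_density a s *\<^sub>R f (x + 1 * s) = ?g s * indicator {0 ..} s" for s
    proof -
      have "exp (- s * a) = exp (a * x) * exp (- (a * (x + s)))"
        by (simp add: distrib_left mult.commute flip: exp_add)
      then show ?thesis
        by (simp add: exponential_density_def h_def split: split_indicator)
    qed
    have "exp_avg a 1 f x = (LINT s|lborel. exponential_density a s *\<^sub>R f (x + 1 * s))"
      unfolding exp_avg_def using a
      by (intro integral_density) (auto simp: exponential_density_nonneg)
    also have "\<dots> = (LINT s|lborel. ?g s * indicator {0 ..} s)"
      unfolding density ..
    also have "\<dots> = exp (a * x) * L - exp (a * x) * G (x + 0)"
      using nn pos h0
      by (subst integral_eq_nn_integral) (auto simp: h_def ennreal_mult' ennreal_indicator)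
    finally show "exp_avg a 1 f x = exp (a * x) * (L - G x)"
      by (simp add: algebra_simps)
  qed
  show ?thesis
    unfolding eq by (auto intro!: derivative_eq_intros G simp: h_def algebra_simps simp flip: exp_add)
qed

text \<open>Reflection at the origin exchanges the two shift directions.\<close>

lemma exp_avg_left_deriv:
  assumes a: "a > 0" and f: "unit_cont f"
  shows "(exp_avg a (-1) f has_real_derivative a * (f x - exp_avg a (-1) f x)) (at x)"
proof -
  let ?f = "\<lambda>t. f (- t)"
  have "unit_cont ?f"
    using f unfolding unit_cont_def
    by (auto intro!: continuous_on_compose2[of UNIV f UNIV] continuous_intros)
  note right = exp_avg_right_deriv[OF a this]
  have "(uminus has_real_derivative -1) (at x)"
    by (auto intro!: derivative_eq_intros)
  from DERIV_chain2[OF right this]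
  have "((\<lambda>x. exp_avg a 1 ?f (- x)) has_real_derivative a * (exp_avg a 1 ?f (- x) - f x) * (-1)) (at x)"
    by simp
  moreover have "exp_avg a (-1) f = (\<lambda>x. exp_avg a 1 ?f (- x))"
    by (simp add: exp_avg_def fun_eq_iff)
  ultimately show ?thesis
    by (simp add: algebra_simps)
qed

lemma unit_cont_exp_avg:
  assumes "a > 0" "unit_cont f" "\<sigma> = 1 \<or> \<sigma> = -1"
  shows "unit_cont (exp_avg a \<sigma> f)"
proof -
  have "isCont (exp_avg a \<sigma> f) x" for x
    using assms exp_avg_right_deriv exp_avg_left_deriv DERIV_isCont by blast
  then show ?thesis
    using assms exp_avg_bounds by (auto simp: unit_cont_def continuous_on_eq_continuous_at)
qed

section \<open>The monotone integral operator and its fixed points\<close>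

definition reaction :: "real \<Rightarrow> (real \<Rightarrow> real) \<Rightarrow> real \<Rightarrow> real"
  where "reaction r \<phi> x = \<phi> (x - r) * (1 - \<phi> x) + \<phi> x"

text \<open>Raise one argument at a time: the delayed value has coefficient \<open>1 - f x\<close>,
  the current value has coefficient \<open>1 - g (x - r)\<close>, and both are nonnegative for
  functions bounded by 1.\<close>

lemma reaction_mono:
  assumes "unit_cont f" "unit_cont g" and le: "\<And>x. f x \<le> g x"
  shows "reaction r f x \<le> reaction r g x"
proof -
  have "reaction r f x \<le> g (x - r) * (1 - f x) + f x"
    unfolding reaction_def using assms unit_contD(4)[OF assms(1)] by (simp add: mult_right_mono)
  also have "\<dots> = g (x - r) + f x * (1 - g (x - r))" by (simp add: algebra_simps)
  also have "\<dots> \<le> g (x - r) + g x * (1 - g (x - r))"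
    using assms unit_contD(4)[OF assms(2)] by (simp add: mult_right_mono)
  finally show ?thesis by (simp add: reaction_def algebra_simps)
qed

lemma unit_cont_shift: "unit_cont f \<Longrightarrow> unit_cont (\<lambda>x. f (x + h))"
  unfolding unit_cont_def
  by (auto intro!: continuous_on_compose2[of UNIV f UNIV] continuous_intros)

text \<open>A nondecreasing \<open>f\<close> lies below its translate by \<open>y - x\<close>, and
  \<open>reaction\<close> is order preserving and commutes with translations.\<close>

lemma mono_reaction:
  assumes "unit_cont f" "mono f"
  shows "mono (reaction r f)"
proof (rule monoI)
  fix x y :: real assume "x \<le> y"
  then have "reaction r f x \<le> reaction r (\<lambda>t. f (t + (y - x))) x"
    using assms unit_cont_shift[OF assms(1)] by (intro reaction_mono) (auto intro: monoD)
  then show "reaction r f x \<le> reaction r f y"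
    by (simp add: reaction_def algebra_simps)
qed

lemma unit_cont_reaction:
  assumes "unit_cont f"
  shows "unit_cont (reaction r f)"
  unfolding unit_cont_def
proof (intro conjI allI)
  show "continuous_on UNIV (reaction r f)"
    unfolding reaction_def[abs_def] using unit_contD(1)[OF assms]
      unit_contD(1)[OF unit_cont_shift[OF assms, of "- r"]]
    by (intro continuous_intros) auto
  fix x
  note b = unit_contD(3,4)[OF assms]
  show "0 \<le> reaction r f x"
    using b[of x] b[of "x - r"] by (simp add: reaction_def)
  show "reaction r f x \<le> 1"
    using mult_right_mono[of "f (x - r)" 1 "1 - f x"] b by (simp add: reaction_def)
qed

section \<open>The inverse of the third-order operator as a composition of averages\<close>

locale factored_operator =
  fixes c D \<mu> a b :: real
  assumes pos: "c > 0" "\<mu> > 0" "a > 0" "b > 0"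
    and factor: "\<And>x. c * x^3 + D * x^2 - c * x - 1 = c * (x - \<mu>) * (x + a) * (x + b)"
begin

text \<open>This is the inverse of \<open>L\<close>. No prefactor appears because
  \<open>c * \<mu> * a * b = 1\<close>, as \<open>vieta\<close> shows. The root
  \<open>\<mu> > 0\<close> needs a forward shift, the roots \<open>- a\<close> and
  \<open>- b\<close> backward ones.\<close>

definition smoothing :: "(real \<Rightarrow> real) \<Rightarrow> real \<Rightarrow> real"
  where "smoothing f = exp_avg a (-1) (exp_avg b (-1) (exp_avg \<mu> 1 f))"

lemma unit_cont_stages:
  assumes "unit_cont f"
  shows "unit_cont (exp_avg \<mu> 1 f)" "unit_cont (exp_avg b (-1) (exp_avg \<mu> 1 f))"
    "unit_cont (smoothing f)"
  unfolding smoothing_def using pos assms by (intro unit_cont_exp_avg; simp)+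

lemma smoothing_mono:
  assumes "unit_cont f" "unit_cont g" "\<And>x. f x \<le> g x"
  shows "smoothing f x \<le> smoothing g x"
  unfolding smoothing_def using pos assms unit_cont_stages
  by (intro exp_avg_mono) auto

lemma mono_smoothing:
  assumes "unit_cont f" "mono f"
  shows "mono (smoothing f)"
  unfolding smoothing_def using pos assms unit_cont_stages
  by (intro mono_exp_avg) auto

lemma smoothing_tendsto_at_top:
  assumes "unit_cont f" "(f \<longlongrightarrow> L) at_top"
  shows "(smoothing f \<longlongrightarrow> L) at_top"
  unfolding smoothing_def using pos assms unit_cont_stages
  by (intro exp_avg_tendsto_at_top) auto

lemma smoothing_tendsto:
  assumes "\<And>n. unit_cont (g n)" "unit_cont f" "\<And>x. (\<lambda>n. g n x) \<longlonglongrightarrow> f x"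
  shows "(\<lambda>n. smoothing (g n) x) \<longlonglongrightarrow> smoothing f x"
  unfolding smoothing_def using pos assms unit_cont_stages
  by (intro exp_avg_tendsto unit_contD(6)) auto

text \<open>The derivative of the outermost average is \<open>a\<close> times a difference of two
  values in [0,1]. The constant does not depend on \<open>f\<close>, so the bound survives pointwise
  limits and yields continuity of the limit of the iteration.\<close>

lemma smoothing_lipschitz:
  assumes "unit_cont f"
  shows "\<bar>smoothing f x - smoothing f y\<bar> \<le> a * \<bar>x - y\<bar>"
proof -
  note u = unit_cont_stages[OF assms]
  have "norm (smoothing f x - smoothing f y) \<le> a * norm (x - y)"
  proof (rule field_differentiable_bound[of UNIV])
    fix z :: real
    show "(smoothing f has_field_derivative
        a * (exp_avg b (-1) (exp_avg \<mu> 1 f) z - smoothing f z)) (at z within UNIV)"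
      unfolding smoothing_def using exp_avg_left_deriv[OF pos(3) u(2)] by simp
    have "\<bar>exp_avg b (-1) (exp_avg \<mu> 1 f) z - smoothing f z\<bar> \<le> 1"
      using unit_contD(3,4)[OF u(2), of z] unit_contD(3,4)[OF u(3), of z] by linarith
    then show "norm (a * (exp_avg b (-1) (exp_avg \<mu> 1 f) z - smoothing f z)) \<le> a"
      using pos by (simp add: abs_mult mult_left_le)
  qed auto
  then show ?thesis by simp
qed

lemma vieta: "c * \<mu> * a * b = 1" "c * (a + b - \<mu>) = D"
proof -
  show 0: "c * \<mu> * a * b = 1"
    using factor[of 0] by simp
  have 1: "D - 1 = c * (1 + (a + b - \<mu>) + (a * b - a * \<mu> - b * \<mu>) - \<mu> * a * b)"
    using factor[of 1] by (simp add: algebra_simps)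
  have 2: "D - 1 = c * (- 1 + (a + b - \<mu>) - (a * b - a * \<mu> - b * \<mu>) - \<mu> * a * b)"
    using factor[of "-1"] by (simp add: algebra_simps)
  \<comment> \<open>Adding the values at 1 and -1 cancels the odd coefficients of the cubic; only
    the quadratic and constant ones remain.\<close>
  have "2 * (D - 1) = 2 * (c * (a + b - \<mu>)) - 2 * (c * \<mu> * a * b)"
    using 1 2 by (simp add: algebra_simps)
  with 0 show "c * (a + b - \<mu>) = D" by simp
qed

text \<open>The factors carry the shift directions $1$ and $-1$ of \<open>exp_avg\<close>, so that they
  rewrite the bounds of \<open>exp_avg_le_exp\<close> and \<open>exp_avg_ge_exp\<close> literally.\<close>

lemma smoothing_multiplier:
  assumes "0 \<le> l" "c * l^3 + D * l^2 - c * l < 1"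
  shows "l < \<mu>"
    "A * (\<mu> / (\<mu> - 1 * l)) * (b / (b - (-1) * l)) * (a / (a - (-1) * l))
      = A / (1 - (c * l^3 + D * l^2 - c * l))"
proof -
  have *: "c * (\<mu> - l) * (l + a) * (l + b) = 1 - (c * l^3 + D * l^2 - c * l)"
    using factor[of l] by (simp add: algebra_simps)
  \<comment> \<open>The symbol of \<open>L\<close> is positive at \<open>l\<close>, which for
    \<open>l \<ge> 0\<close> forces \<open>l < \<mu>\<close>; this is the convergence condition for
    the forward average of \<open>exp (l * x)\<close>.\<close>
  have "0 < (c * (l + a) * (l + b)) * (\<mu> - l)"
    using assms(2) * by (simp add: algebra_simps)
  moreover have "0 < c * (l + a) * (l + b)"
    using assms(1) pos by simp
  ultimately show l: "l < \<mu>"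
    using zero_less_mult_pos by fastforce
  have "A * (\<mu> / (\<mu> - 1 * l)) * (b / (b - (-1) * l)) * (a / (a - (-1) * l))
      = A * (\<mu> * a * b) / ((\<mu> - l) * (l + a) * (l + b))"
    using l pos assms(1) by (simp add: field_simps)
  also have "\<dots> = A * (c * \<mu> * a * b) / (c * (\<mu> - l) * (l + a) * (l + b))"
    using pos(1) by simp
  finally show "A * (\<mu> / (\<mu> - 1 * l)) * (b / (b - (-1) * l)) * (a / (a - (-1) * l))
      = A / (1 - (c * l^3 + D * l^2 - c * l))"
    unfolding * vieta(1) by simp
qed

lemma smoothing_le_exp:
  assumes f: "unit_cont f"
    and l: "0 \<le> l" "c * l^3 + D * l^2 - c * l < 1" and k: "0 \<le> k" "c * k^3 + D * k^2 - c * k < 1"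
    and le: "\<And>x. f x \<le> A * exp (l * x) + B * exp (k * x)"
  shows "smoothing f x \<le> A / (1 - (c * l^3 + D * l^2 - c * l)) * exp (l * x)
    + B / (1 - (c * k^3 + D * k^2 - c * k)) * exp (k * x)"
  unfolding smoothing_def smoothing_multiplier(2)[OF l, symmetric] smoothing_multiplier(2)[OF k, symmetric]
  using pos smoothing_multiplier(1)[OF l] smoothing_multiplier(1)[OF k] l k
  by (intro exp_avg_le_exp unit_contD[OF f] unit_contD[OF unit_cont_stages(1)[OF f]]
     unit_contD[OF unit_cont_stages(2)[OF f]] le) auto

lemma smoothing_ge_exp:
  assumes f: "unit_cont f"
    and l: "0 \<le> l" "c * l^3 + D * l^2 - c * l < 1" and k: "0 \<le> k" "c * k^3 + D * k^2 - c * k < 1"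
    and le: "\<And>x. A * exp (l * x) + B * exp (k * x) \<le> f x"
  shows "A / (1 - (c * l^3 + D * l^2 - c * l)) * exp (l * x)
    + B / (1 - (c * k^3 + D * k^2 - c * k)) * exp (k * x) \<le> smoothing f x"
  unfolding smoothing_def smoothing_multiplier(2)[OF l, symmetric] smoothing_multiplier(2)[OF k, symmetric]
  using pos smoothing_multiplier(1)[OF l] smoothing_multiplier(1)[OF k] l k
  by (intro exp_avg_ge_exp unit_contD[OF f] unit_contD[OF unit_cont_stages(1)[OF f]]
     unit_contD[OF unit_cont_stages(2)[OF f]] le) auto

end

section \<open>From fixed points to solutions of the profile equation\<close>

lemma profile_derivatives:
  assumes S: "open S"
    and f1: "\<And>x. x \<in> S \<Longrightarrow> (f has_real_derivative f1 x) (at x)"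
    and f2: "\<And>x. x \<in> S \<Longrightarrow> (f1 has_real_derivative f2 x) (at x)"
    and f3: "\<And>x. x \<in> S \<Longrightarrow> (f2 has_real_derivative f3 x) (at x)"
  shows "thrice_differentiable_on f S"
    and "x \<in> S \<Longrightarrow> profile_lhs c D r f x
      = c * f3 x + D * f2 x - c * f1 x + f (x - r) * (1 - f x)"
proof -
  have d1: "deriv f x = f1 x" if "x \<in> S" for x
    using DERIV_imp_deriv[OF f1[OF that]] .
  have D2: "(deriv f has_real_derivative f2 x) (at x)" if "x \<in> S" for x
    using has_field_derivative_transform_within_open[OF f2[OF that] S that] d1 by simp
  have d2: "deriv (deriv f) x = f2 x" if "x \<in> S" for x
    using DERIV_imp_deriv[OF D2[OF that]] .
  \<comment> \<open>Openness of \<open>S\<close> enters here and for \<open>D2\<close>: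
    differentiating an iterated \<open>deriv\<close> needs its formula in a whole neighbourhood of
    \<open>x\<close>.\<close>
  have D3: "(deriv (deriv f) has_real_derivative f3 x) (at x)" if "x \<in> S" for x
    using has_field_derivative_transform_within_open[OF f3[OF that] S that] d2 by simp
  have d3: "deriv (deriv (deriv f)) x = f3 x" if "x \<in> S" for x
    using DERIV_imp_deriv[OF D3[OF that]] .
  show "thrice_differentiable_on f S"
    unfolding thrice_differentiable_on_def
  proof (intro allI impI ballI)
    fix k :: nat and x assume "k < 3" "x \<in> S"
    then consider "k = 0" | "k = 1" | "k = 2" by linarith
    then show "(deriv ^^ k) f differentiable at x"
      using f1[OF \<open>x \<in> S\<close>] D2[OF \<open>x \<in> S\<close>] D3[OF \<open>x \<in> S\<close>]
      by cases (auto simp: numeral_2_eq_2 real_differentiable_def)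
  qed
  show "profile_lhs c D r f x
      = c * f3 x + D * f2 x - c * f1 x + f (x - r) * (1 - f x)" if "x \<in> S"
    using d1[OF that] d2[OF that] d3[OF that]
    by (simp add: profile_lhs_def numeral_2_eq_2 numeral_3_eq_3)
qed

context factored_operator
begin

text \<open>Each stage obeys a first-order equation, so three derivatives of \<open>\<phi>\<close>
  are linear combinations of \<open>H\<close>, \<open>u0\<close>, \<open>u1\<close> and
  \<open>\<phi>\<close>. \<open>H\<close> itself is never differentiated and need only be
  continuous.\<close>

lemma fixed_point_imp_solution:
  assumes \<phi>: "unit_cont \<phi>" and fixed: "smoothing (reaction r \<phi>) = \<phi>"
  shows "profile_solution c D r \<phi>"
proof -
  define H where "H = reaction r \<phi>"
  define u0 where "u0 = exp_avg \<mu> 1 H"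
  define u1 where "u1 = exp_avg b (-1) u0"
  have H: "unit_cont H"
    using unit_cont_reaction[OF \<phi>] by (simp add: H_def)
  note u = unit_cont_stages[OF H, folded u0_def, folded u1_def]
  have \<phi>_eq: "\<phi> = exp_avg a (-1) u1"
    using fixed by (simp add: smoothing_def u0_def u1_def H_def)
  have d0: "(u0 has_real_derivative \<mu> * (u0 x - H x)) (at x)" for x
    using exp_avg_right_deriv[OF pos(2) H] by (simp add: u0_def)
  have d1: "(u1 has_real_derivative b * (u0 x - u1 x)) (at x)" for x
    using exp_avg_left_deriv[OF pos(4) u(1)] by (simp add: u1_def)
  have d2: "(\<phi> has_real_derivative a * (u1 x - \<phi> x)) (at x)" for x
    using exp_avg_left_deriv[OF pos(3) u(2)] by (simp flip: \<phi>_eq)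
  define f1 where "f1 x = a * (u1 x - \<phi> x)" for x
  define f2 where "f2 x = a * (b * (u0 x - u1 x) - f1 x)" for x
  define f3 where "f3 x = a * (b * (\<mu> * (u0 x - H x) - b * (u0 x - u1 x)) - f2 x)" for x
  have e1: "(\<phi> has_real_derivative f1 x) (at x)" for x
    using d2 by (simp add: f1_def)
  have e2: "(f1 has_real_derivative f2 x) (at x)" for x
    unfolding f1_def[abs_def] f2_def
    by (rule derivative_eq_intros d1 d2 refl | simp)+
  have e3: "(f2 has_real_derivative f3 x) (at x)" for x
    unfolding f2_def[abs_def] f3_def
    by (rule derivative_eq_intros d0 d1 e2 refl | simp add: f2_def)+
  note deriv = profile_derivatives[of UNIV \<phi> f1 f2 f3, OF open_UNIV e1 e2 e3]
  have "profile_lhs c D r \<phi> x = 0" for x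
  proof -
    have y: "c * a^3 - D * a^2 - c * a + 1 = 0"
      using factor[of "- a"] by simp
    have z: "D * (a * b) + 1 - c * (a * b) * (a + b) = 0"
      unfolding vieta(2)[symmetric] using vieta(1) by (simp add: algebra_simps)
    \<comment> \<open>Sorted by the differences of consecutive stages, the coefficients vanish by
      \<open>c * \<mu> * a * b = 1\<close>, by the formula for \<open>D\<close>, and because
      \<open>- a\<close> is a root of the cubic.\<close>
    have "c * f3 x + D * f2 x - c * f1 x + H x - \<phi> x
        = (c * \<mu> * a * b - 1) * (u0 x - H x)
          + (D * (a * b) + 1 - c * (a * b) * (a + b)) * (u0 x - u1 x)
          + (c * a^3 - D * a^2 - c * a + 1) * (u1 x - \<phi> x)"
      by (simp add: f3_def f2_def f1_def algebra_simps power2_eq_square power3_eq_cube)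
    then have "c * f3 x + D * f2 x - c * f1 x + H x - \<phi> x = 0"
      unfolding y z vieta(1) by simp
    then show ?thesis
      using deriv(2)[of x c D r] by (simp add: H_def reaction_def)
  qed
  then show ?thesis
    using deriv(1) by (simp add: profile_solution_def)
qed

section \<open>Upper and lower barriers and the monotone iteration\<close>

definition wave_map :: "real \<Rightarrow> (real \<Rightarrow> real) \<Rightarrow> real \<Rightarrow> real"
  where "wave_map r \<phi> = smoothing (reaction r \<phi>)"

lemma unit_cont_wave_map: "unit_cont \<phi> \<Longrightarrow> unit_cont (wave_map r \<phi>)"
  by (simp add: wave_map_def unit_cont_stages unit_cont_reaction)

lemma wave_map_mono:
  assumes "unit_cont f" "unit_cont g" "\<And>x. f x \<le> g x"
  shows "wave_map r f x \<le> wave_map r g x"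
  unfolding wave_map_def using assms
  by (intro smoothing_mono unit_cont_reaction reaction_mono)

lemma mono_wave_map: "unit_cont \<phi> \<Longrightarrow> mono \<phi> \<Longrightarrow> mono (wave_map r \<phi>)"
  by (simp add: wave_map_def mono_smoothing unit_cont_reaction mono_reaction)

text \<open>Dropping the quadratic loss, \<open>reaction\<close> multiplies
  \<open>exp (\<eta> * x)\<close> by at most \<open>1 + exp (- (\<eta> * r))\<close>. The
  characteristic equation makes the multiplier of \<open>smoothing\<close> exactly the reciprocal of
  this factor.\<close>

lemma wave_map_upper:
  assumes \<eta>: "\<eta> > 0" "char_fun c D r \<eta> = 0"
  defines "upper \<equiv> (\<lambda>x. min 1 (exp (\<eta> * x)))"
  shows "unit_cont upper" "mono upper" "wave_map r upper x \<le> upper x"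
proof -
  show upper: "unit_cont upper"
    unfolding unit_cont_def upper_def by (auto intro!: continuous_intros)
  show "mono upper"
    unfolding upper_def using \<eta>(1) by (intro monoI min.mono) auto
  have p: "c * \<eta>^3 + D * \<eta>^2 - c * \<eta> = - exp (- (\<eta> * r))"
    using \<eta>(2) by (simp add: char_fun_def)
  have lt: "c * \<eta>^3 + D * \<eta>^2 - c * \<eta> < 1"
    unfolding p using exp_gt_zero[of "- (\<eta> * r)"] by linarith
  have le: "reaction r upper x \<le> (1 + exp (- (\<eta> * r))) * exp (\<eta> * x) + 0 * exp (\<eta> * x)" for x
  proof -
    have "reaction r upper x \<le> upper (x - r) * 1 + upper x"
      unfolding reaction_def using unit_contD(3)[OF upper]
      by (intro add_mono mult_left_mono) auto
    also have "\<dots> \<le> exp (\<eta> * (x - r)) + exp (\<eta> * x)"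
      by (simp add: upper_def)
    finally show ?thesis
      by (simp add: algebra_simps flip: exp_add)
  qed
  have "wave_map r upper x \<le> exp (\<eta> * x)"
    using smoothing_le_exp[OF unit_cont_reaction[OF upper] _ lt _ lt le, of x] \<eta>(1)
      exp_gt_zero[of "- (\<eta> * r)"] unfolding p wave_map_def
    by (simp add: add_pos_pos less_imp_neq[symmetric])
  then show "wave_map r upper x \<le> upper x"
    using unit_contD(4)[OF unit_cont_wave_map[OF upper]] by (simp add: upper_def)
qed

text \<open>The \<open>\<eta>\<close> term is reproduced exactly, as for the upper barrier. The
  quadratic loss is absorbed by the \<open>\<kappa>\<close> term, where \<open>char_fun\<close> is
  negative and \<open>q\<close> is large.\<close>

lemma wave_map_lower:
  assumes r: "r \<ge> 0" and \<eta>: "\<eta> > 0" "char_fun c D r \<eta> = 0"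
    and \<kappa>: "\<eta> < \<kappa>" "\<kappa> \<le> 2 * \<eta>"
    and q: "q \<ge> 1" "q * char_fun c D r \<kappa> \<le> -1"
  defines "lower \<equiv> (\<lambda>x. max 0 (exp (\<eta> * x) - q * exp (\<kappa> * x)))"
  shows "unit_cont lower" "lower x \<le> min 1 (exp (\<eta> * x))" "lower x \<le> wave_map r lower x"
proof -
  have le_exp: "lower x \<le> exp (\<eta> * x)" for x
    using q by (simp add: lower_def)
  have le_0: "lower x = 0" if "x \<ge> 0" for x
  proof -
    have "exp (\<eta> * x) \<le> 1 * exp (\<kappa> * x)"
      using \<kappa> that by (simp add: mult_right_mono)
    also have "\<dots> \<le> q * exp (\<kappa> * x)"
      using q by (intro mult_right_mono) auto
    finally show ?thesis by (simp add: lower_def)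
  qed
  have le_1: "lower x \<le> 1" for x
  proof (cases "x \<ge> 0")
    case False
    then have "exp (\<eta> * x) \<le> 1"
      using \<eta> by (simp add: mult_nonneg_nonpos)
    with le_exp[of x] show ?thesis by linarith
  qed (simp add: le_0)
  show lower: "unit_cont lower"
    unfolding unit_cont_def using le_1 by (auto intro!: continuous_intros simp: lower_def)
  show "lower x \<le> min 1 (exp (\<eta> * x))"
    using le_1 le_exp by simp
  \<comment> \<open>The barrier vanishes for \<open>x \<ge> 0\<close> since
    \<open>q \<ge> 1\<close>; for \<open>x < 0\<close> the product is at most
    \<open>exp (2 * \<eta> * x)\<close>, and \<open>\<kappa> \<le> 2 * \<eta>\<close>
    finishes.\<close>
  have prod: "lower (x - r) * lower x \<le> exp (\<kappa> * x)" for x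
  proof (cases "x \<ge> 0")
    case False
    have "lower (x - r) * lower x \<le> exp (\<eta> * x) * exp (\<eta> * x)"
    proof (intro mult_mono le_exp)
      have "exp (\<eta> * (x - r)) \<le> exp (\<eta> * x)"
        using \<eta> r by simp
      with le_exp[of "x - r"] show "lower (x - r) \<le> exp (\<eta> * x)" by linarith
    qed (auto simp: lower_def)
    also have "\<dots> = exp ((2 * \<eta>) * x)"
      by (simp flip: exp_add)
    also have "\<dots> \<le> exp (\<kappa> * x)"
      using \<kappa> False by (simp add: mult_right_mono_neg)
    finally show ?thesis .
  qed (simp add: le_0)
  have p\<eta>: "c * \<eta>^3 + D * \<eta>^2 - c * \<eta> = - exp (- (\<eta> * r))"
    using \<eta>(2) by (simp add: char_fun_def)
  have lt\<eta>: "c * \<eta>^3 + D * \<eta>^2 - c * \<eta> < 1"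
    unfolding p\<eta> using exp_gt_zero[of "- (\<eta> * r)"] by linarith
  have "char_fun c D r \<kappa> < 0"
    using q by (smt (verit) mult_nonneg_nonneg)
  then have lt\<kappa>: "c * \<kappa>^3 + D * \<kappa>^2 - c * \<kappa> < 1"
    using exp_gt_zero[of "- (\<kappa> * r)"] unfolding char_fun_def by linarith
  \<comment> \<open>The first summand collects the linear contributions of the
    \<open>\<kappa>\<close> term, the final 1 pays for \<open>prod\<close>. The difference
    \<open>q * ?w - Q\<close> equals \<open>- q * char_fun c D r \<kappa> - 1\<close>, which is
    nonnegative.\<close>
  define Q where "Q = q * (1 + exp (- (\<kappa> * r))) + 1"
  have ge: "(1 + exp (- (\<eta> * r))) * exp (\<eta> * x)
      + (- Q) * exp (\<kappa> * x) \<le> reaction r lower x" for x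
  proof -
    have "exp (\<eta> * (x - r)) - q * exp (\<kappa> * (x - r)) + (exp (\<eta> * x) - q * exp (\<kappa> * x))
        \<le> lower (x - r) + lower x"
      by (simp add: lower_def)
    with prod[of x] show ?thesis
      by (simp add: Q_def reaction_def algebra_simps flip: exp_add)
  qed
  let ?w = "1 - (c * \<kappa>^3 + D * \<kappa>^2 - c * \<kappa>)"
  have "Q \<le> q * ?w"
    using q(2) by (simp add: Q_def char_fun_def algebra_simps)
  then have "Q / ?w \<le> q"
    using lt\<kappa> by (simp add: divide_le_eq)
  then have le: "Q / ?w * exp (\<kappa> * x) \<le> q * exp (\<kappa> * x)"
    by (intro mult_right_mono) auto
  have "(1 + exp (- (\<eta> * r))) / (1 - (- exp (- (\<eta> * r)))) = 1"
    using exp_gt_zero[of "- (\<eta> * r)"] by (simp add: add_pos_pos less_imp_neq[symmetric])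
  with smoothing_ge_exp[OF unit_cont_reaction[OF lower] _ lt\<eta> _ lt\<kappa> ge, of x] le \<eta> \<kappa>
  have "exp (\<eta> * x) - q * exp (\<kappa> * x) \<le> wave_map r lower x"
    unfolding p\<eta> wave_map_def by simp
  then show "lower x \<le> wave_map r lower x"
    using unit_contD(3)[OF unit_cont_wave_map[OF lower]] by (simp add: lower_def)
qed

text \<open>Iteration from the upper barrier decreases through nondecreasing functions. The upper
  barrier gives the limit at minus infinity, and the lower one keeps the pointwise limit from being
  zero.\<close>

lemma monotone_wave_exists:
  assumes r: "r \<ge> 0" and \<eta>: "\<eta> > 0" "char_fun c D r \<eta> = 0"
    and \<kappa>: "\<eta> < \<kappa>" "\<kappa> \<le> 2 * \<eta>" "char_fun c D r \<kappa> < 0"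
  shows "\<exists>\<phi>. monotone_wave c D r \<phi>"
proof -
  define q where "q = max 1 (1 / - char_fun c D r \<kappa>)"
  have q: "q \<ge> 1" "q * char_fun c D r \<kappa> \<le> -1"
  proof -
    show "q \<ge> 1" by (simp add: q_def)
    have "1 / - char_fun c D r \<kappa> \<le> q" by (simp add: q_def)
    then show "q * char_fun c D r \<kappa> \<le> -1"
      using \<kappa>(3) by (simp add: divide_simps mult.commute split: if_splits)
  qed
  define upper where "upper = (\<lambda>x. min 1 (exp (\<eta> * x)))"
  define lower where "lower = (\<lambda>x. max 0 (exp (\<eta> * x) - q * exp (\<kappa> * x)))"
  have upper: "unit_cont upper" "mono upper" "wave_map r upper x \<le> upper x" for x
    using wave_map_upper[OF \<eta>] unfolding upper_def by blast+
  have lower: "unit_cont lower" "lower x \<le> upper x" "lower x \<le> wave_map r lower x" for x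
    using wave_map_lower[OF r \<eta> \<kappa>(1,2) q] unfolding lower_def upper_def by blast+
  define it where "it n = (wave_map r ^^ n) upper" for n
  have it: "unit_cont (it n) \<and> mono (it n) \<and> (\<forall>x. lower x \<le> it n x \<and> it (Suc n) x \<le> it n x)" for n
  proof (induction n)
    case 0
    then show ?case using upper lower by (simp add: it_def)
  next
    case (Suc n)
    have eq: "it (Suc m) = wave_map r (it m)" for m
      by (simp add: it_def)
    have uc: "unit_cont (it (Suc n))"
      using Suc unit_cont_wave_map by (simp add: eq)
    have "lower x \<le> it (Suc n) x" for x
      using lower(3)[of x] wave_map_mono[OF lower(1), of "it n" r x] Suc unfolding eq
      by (meson order_trans)
    moreover have "it (Suc (Suc n)) x \<le> it (Suc n) x" for x
      using wave_map_mono[of "it (Suc n)" "it n" r x] uc Suc by (simp add: eq)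
    ultimately show ?case
      using uc Suc mono_wave_map by (simp add: eq)
  qed
  note unit = unit_contD[OF conjunct1[OF it]]
  define \<phi> where "\<phi> x = lim (\<lambda>n. it n x)" for x
  have lim: "(\<lambda>n. it n x) \<longlonglongrightarrow> \<phi> x" for x
  proof -
    have "decseq (\<lambda>n. it n x)"
      using it by (intro decseq_SucI) auto
    then have "convergent (\<lambda>n. it n x)"
      using unit(3,4) by (intro Bseq_monoseq_convergent)
        (auto intro!: BseqI'[of _ 1] simp: decseq_imp_monoseq)
    then show ?thesis
      by (simp add: \<phi>_def convergent_LIMSEQ_iff)
  qed
  have bounds: "lower x \<le> \<phi> x" "\<phi> x \<le> upper x" "0 \<le> \<phi> x" "\<phi> x \<le> 1" for x
  proof -
    have "decseq (\<lambda>n. it n x)"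
      using it by (intro decseq_SucI) auto
    from decseq_ge[OF this lim, of 0] show "\<phi> x \<le> upper x"
      by (simp add: it_def)
    show "lower x \<le> \<phi> x" "0 \<le> \<phi> x" "\<phi> x \<le> 1"
      using it unit(3,4) by (auto intro: LIMSEQ_le_const[OF lim] LIMSEQ_le_const2[OF lim])
  qed
  have "mono \<phi>"
    using it by (intro monoI LIMSEQ_le[OF lim lim]) (auto dest: monoD)
  \<comment> \<open>Only the iterates with index \<open>Suc n\<close> are outputs of
    \<open>smoothing\<close> and so carry the Lipschitz constant \<open>a\<close>; the starting
    function need not.\<close>
  have "\<bar>\<phi> x - \<phi> y\<bar> \<le> a * \<bar>x - y\<bar>" for x y
  proof (rule LIMSEQ_le_const2)
    show "(\<lambda>n. \<bar>it (Suc n) x - it (Suc n) y\<bar>) \<longlonglongrightarrow> \<bar>\<phi> x - \<phi> y\<bar>"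
      by (intro tendsto_intros LIMSEQ_Suc lim)
    show "\<exists>N. \<forall>n\<ge>N. \<bar>it (Suc n) x - it (Suc n) y\<bar> \<le> a * \<bar>x - y\<bar>"
      using smoothing_lipschitz[OF unit_cont_reaction] it
      by (auto simp: it_def wave_map_def)
  qed
  then have "a-lipschitz_on UNIV \<phi>"
    using pos by (intro lipschitz_onI) (auto simp: dist_real_def)
  then have \<phi>: "unit_cont \<phi>"
    using bounds lipschitz_on_continuous_on by (auto simp: unit_cont_def)
  have "wave_map r \<phi> x = \<phi> x" for x
  proof (rule LIMSEQ_unique)
    show "(\<lambda>n. it (Suc n) x) \<longlonglongrightarrow> \<phi> x"
      by (intro LIMSEQ_Suc lim)
    have "(\<lambda>n. reaction r (it n) x) \<longlonglongrightarrow> reaction r \<phi> x" for x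
      unfolding reaction_def by (intro tendsto_intros lim)
    then have "(\<lambda>n. smoothing (reaction r (it n)) x) \<longlonglongrightarrow> smoothing (reaction r \<phi>) x"
      using it \<phi> by (intro smoothing_tendsto unit_cont_reaction) auto
    then show "(\<lambda>n. it (Suc n) x) \<longlonglongrightarrow> wave_map r \<phi> x"
      by (simp add: it_def wave_map_def)
  qed
  then have fixed: "smoothing (reaction r \<phi>) = \<phi>"
    by (simp add: wave_map_def fun_eq_iff)
  define L where "L = (SUP x. \<phi> x)"
  have L: "(\<phi> \<longlongrightarrow> L) at_top"
    unfolding L_def using \<open>mono \<phi>\<close> bounds(4) by (rule mono_bounded_tendsto_at_top)
  have "((\<lambda>x. \<phi> (x - r)) \<longlongrightarrow> L) at_top"
    using filterlim_compose[OF L filterlim_tendsto_add_at_top[OF tendsto_const[of "-r"] filterlim_ident]]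
    by simp
  then have "(reaction r \<phi> \<longlongrightarrow> L * (1 - L) + L) at_top"
    unfolding reaction_def[abs_def] by (intro tendsto_intros L)
  from smoothing_tendsto_at_top[OF unit_cont_reaction[OF \<phi>] this]
  have "L = L * (1 - L) + L"
    using L by (intro tendsto_unique[of at_top \<phi>]) (auto simp: fixed)
  moreover have "L > 0"
  proof -
    \<comment> \<open>At this point \<open>q * exp ((\<kappa> - \<eta>) * x) = 1 / 2\<close>, so the
      lower barrier equals half of \<open>exp (\<eta> * x)\<close>.\<close>
    define x where "x = - ln (2 * q) / (\<kappa> - \<eta>)"
    have "\<kappa> * x = (\<kappa> - \<eta>) * x + \<eta> * x"
      by (simp add: algebra_simps)
    then have "q * exp (\<kappa> * x) = q * exp ((\<kappa> - \<eta>) * x) * exp (\<eta> * x)"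
      by (simp only: exp_add mult.assoc)
    also have "\<dots> = 1 / 2 * exp (\<eta> * x)"
      using \<kappa> q by (simp add: x_def exp_minus)
    finally have "0 < exp (\<eta> * x) - q * exp (\<kappa> * x)"
      using exp_gt_zero[of "\<eta> * x"] by linarith
    then have "lower x > 0" by (simp add: lower_def)
    then have "\<phi> x > 0" using bounds(1)[of x] by simp
    moreover have "\<phi> x \<le> L"
      using \<open>mono \<phi>\<close> by (intro tendsto_lowerbound[OF L])
        (auto simp: eventually_at_top_linorder intro: monoD)
    ultimately show ?thesis by simp
  qed
  ultimately have "L = 1" by simp
  have "filterlim (\<lambda>x. \<eta> * x) at_bot at_bot"
    using filterlim_tendsto_pos_mult_at_bot[OF tendsto_const \<eta>(1) filterlim_ident] .
  then have "((\<lambda>x. exp (\<eta> * x)) \<longlongrightarrow> 0) at_bot"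
    by (rule filterlim_compose[OF exp_at_bot])
  moreover have "\<phi> x \<le> exp (\<eta> * x)" for x
    using bounds(2)[of x] by (simp add: upper_def)
  ultimately have "(\<phi> \<longlongrightarrow> 0) at_bot"
    using bounds(3) by (intro tendsto_sandwich[of "\<lambda>_. 0" \<phi> at_bot "\<lambda>x. exp (\<eta> * x)" 0]) auto
  with L \<open>L = 1\<close> \<open>mono \<phi>\<close> fixed_point_imp_solution[OF \<phi> fixed]
  have "monotone_wave c D r \<phi>"
    by (simp add: monotone_wave_def)
  then show ?thesis by blast
qed

end

section \<open>Roots of the characteristic functions\<close>

text \<open>Differences of the root equations are divided by the nonzero gaps between roots, twice
  in succession; this yields the three relations between roots and coefficients.\<close>

lemma factorization_of_three_roots:
  fixes c D :: real
  assumes dist: "s \<noteq> t" "s \<noteq> u" "t \<noteq> u"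
    and roots: "c * s^3 + D * s^2 - c * s - 1 = 0" "c * t^3 + D * t^2 - c * t - 1 = 0"
      "c * u^3 + D * u^2 - c * u - 1 = 0"
  shows "c * x^3 + D * x^2 - c * x - 1 = c * (x - s) * (x - t) * (x - u)"
proof -
  have "(s - t) * (c * (s^2 + s * t + t^2) + D * (s + t) - c) = 0"
    using roots(1,2) by algebra
  then have st: "c * (s^2 + s * t + t^2) + D * (s + t) - c = 0"
    using dist by simp
  have "(s - u) * (c * (s^2 + s * u + u^2) + D * (s + u) - c) = 0"
    using roots(1,3) by algebra
  then have su: "c * (s^2 + s * u + u^2) + D * (s + u) - c = 0"
    using dist by simp
  have "(t - u) * (c * (s + t + u) + D) = 0"
    using st su by algebra
  then have sum: "D = - c * (s + t + u)"
    using dist by simp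
  have pair: "- c = c * (s * t + s * u + t * u)"
    using st sum by algebra
  have one: "- 1 = - c * s * t * u"
    using roots(1) sum pair by algebra
  have "D * x^2 = - (c * (s + t + u)) * x^2" "c * x = - (c * (s * t + s * u + t * u)) * x"
    using sum pair by (metis mult_minus_left, metis minus_minus)
  then show ?thesis
    using one by (simp add: algebra_simps power2_eq_square power3_eq_cube)
qed

text \<open>The cubic \<open>p\<close> changes sign between \<open>- K\<close>, \<open>- l\<close>,
  0 and \<open>K\<close>. The hypothesis on \<open>l\<close> supplies the decisive sign,
  \<open>p (- l) = 2 * D * l^2 > 0\<close>.\<close>

lemma factored_operator_exists:
  fixes c D :: real
  assumes cD: "c > 0" "D > 0" and l: "l > 0" "c * l^3 + D * l^2 - c * l + 1 = 0"
  shows "\<exists>\<mu> a b. factored_operator c D \<mu> a b"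
proof -
  define p where "p x = c * x^3 + D * x^2 - c * x - 1" for x
  have cont: "continuous_on S p" for S
    unfolding p_def by (intro continuous_intros)
  have p0: "p 0 < 0" by (simp add: p_def)
  have "p (- l) = 2 * D * l^2"
    using l(2) by (simp add: p_def)
  then have pl: "p (- l) > 0" using cD l by simp
  \<comment> \<open>Large enough that the cubic term fixes the signs at both ends:
    \<open>c * K > D + 1\<close> serves \<open>p K\<close>, \<open>c * K - D > 2 * c\<close> serves
    \<open>p (- K)\<close>, and \<open>K > l\<close> puts \<open>- K\<close> left of
    \<open>- l\<close>.\<close>
  define K where "K = 2 + l + D / c + 1 / c"
  have K: "K > 2" "K > l"
    using cD l by (auto simp: K_def add_pos_pos)
  have cK: "c * K = 2 * c + c * l + D + 1"
    using cD by (simp add: K_def field_simps)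
  then have cK': "c * K > D + 1" "c * K - D > 2 * c"
    using cD l mult_pos_pos[of c l] by linarith+
  have "K * K > 2 * 2"
    using K by (intro mult_strict_mono) auto
  then have KK: "K * K - 1 > 1" by simp
  have "p K > 0"
  proof -
    have "c * K * 1 \<le> c * K * (K * K - 1)"
      using cD K KK by (intro mult_left_mono) auto
    moreover have "D * (K * K) > 0" using cD K by simp
    moreover have "p K = c * K * (K * K - 1) + D * (K * K) - 1"
      by (simp add: p_def power2_eq_square power3_eq_cube algebra_simps)
    ultimately show ?thesis using cK' cD by linarith
  qed
  have "p (- K) < 0"
  proof -
    have "2 * c * (1 * K) \<le> (c * K - D) * (K * K)"
      using cD K cK' by (intro mult_mono) auto
    moreover have "p (- K) = - ((c * K - D) * (K * K)) + c * K - 1"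
      by (simp add: p_def power2_eq_square power3_eq_cube algebra_simps)
    moreover have "c * K > 0" using cD K by simp
    ultimately show ?thesis by (simp add: algebra_simps)
  qed
  obtain s where s: "- K \<le> s" "s \<le> - l" "p s = 0"
    using IVT'[of p "- K" 0 "- l"] \<open>p (- K) < 0\<close> pl K cont by auto
  obtain t where t: "- l \<le> t" "t \<le> 0" "p t = 0"
    using IVT2'[of p 0 0 "- l"] pl p0 l cont by auto
  obtain u where u: "0 \<le> u" "u \<le> K" "p u = 0"
    using IVT'[of p 0 0 K] \<open>p K > 0\<close> p0 K cont by auto
  have "s \<noteq> - l" "t \<noteq> - l" "t \<noteq> 0" "u \<noteq> 0"
    using s t u pl p0 by auto
  then have ord: "s < t" "t < 0" "0 < u"
    using s t u by auto
  have "factored_operator c D u (- t) (- s)"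
  proof
    show "c * x^3 + D * x^2 - c * x - 1 = c * (x - u) * (x + - t) * (x + - s)" for x
      using factorization_of_three_roots[of u t s c D x] s t u ord by (simp add: p_def)
  qed (use cD ord in auto)
  then show ?thesis by blast
qed

section \<open>Convexity and the first two positive roots\<close>

lemma char_fun_deriv:
  "(char_fun c D r has_real_derivative (3 * c * x^2 + 2 * D * x - c - r * exp (- (x * r)))) (at x)"
  "((\<lambda>x. 3 * c * x^2 + 2 * D * x - c - r * exp (- (x * r))) has_real_derivative
    (6 * c * x + 2 * D + r^2 * exp (- (x * r)))) (at x)"
  unfolding char_fun_def[abs_def]
  by (auto intro!: derivative_eq_intros simp: power2_eq_square)

lemma convex_on_char_fun:
  assumes "c > 0" "D > 0"
  shows "convex_on {0..} (char_fun c D r)"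
  using assms by (intro f''_ge0_imp_convex[OF _ char_fun_deriv]) auto

text \<open>The function is positive at 0 and from 1 on, and negative at \<open>m\<close>, so there
  is a root on each side of \<open>m\<close>. Convexity makes these roots consecutive and the
  function negative between them.\<close>

lemma char_fun_next_roots:
  assumes cD: "c > 0" "D > 0" and m: "0 < m" "char_fun c D r m < 0"
  obtains \<eta>1 \<eta>2 where "next_root_after (char_fun c D r) 0 \<eta>1"
    "next_root_after (char_fun c D r) \<eta>1 \<eta>2"
    "\<And>x. \<eta>1 < x \<Longrightarrow> x < \<eta>2 \<Longrightarrow> char_fun c D r x < 0"
proof -
  define F where "F = char_fun c D r"
  note Fm = m(2)[folded F_def]
  have cont: "continuous_on S F" for S
    unfolding F_def by (intro continuous_at_imp_continuous_on ballI DERIV_isCont[OF char_fun_deriv(1)])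
  have F0: "F 0 > 0" by (simp add: F_def char_fun_def)
  have pos: "F x > 0" if "x \<ge> 1" for x
  proof -
    have "c * x * 1 \<le> c * x * (x * x)"
      using that cD mult_mono[of 1 x 1 x] by (intro mult_left_mono) auto
    moreover have "0 < D * x^2" using that cD by simp
    moreover have "F x = c * x * (x * x) + D * x^2 - c * x + exp (- (x * r))"
      by (simp add: F_def char_fun_def power3_eq_cube)
    ultimately show ?thesis using exp_gt_zero[of "- (x * r)"] by linarith
  qed
  have "m < 1" using pos[of m] Fm by linarith
  obtain \<eta>1 where \<eta>1: "0 \<le> \<eta>1" "\<eta>1 \<le> m" "F \<eta>1 = 0"
    using IVT2'[of F m 0 0, OF _ _ _ cont] F0 Fm m by auto
  obtain \<eta>2 where \<eta>2: "m \<le> \<eta>2" "\<eta>2 \<le> 1" "F \<eta>2 = 0"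
    using IVT'[of F m 0 1, OF _ _ _ cont] pos[of 1] Fm \<open>m < 1\<close> by auto
  have ne: "\<eta>1 \<noteq> 0" "\<eta>1 \<noteq> m" "\<eta>2 \<noteq> m"
    using \<eta>1 \<eta>2 F0 Fm by auto
  \<comment> \<open>A chord whose ends are nonpositive, one of them strictly, is negative in its
    interior; convexity puts \<open>F\<close> below it.\<close>
  have between: "F z < 0" if "0 \<le> x" "0 \<le> y" "F x \<le> 0" "F y < 0" "z \<in> open_segment x y" for x y z
  proof -
    obtain u where u: "0 < u" "u < 1" "z = (1 - u) *\<^sub>R x + u *\<^sub>R y"
      using \<open>z \<in> open_segment x y\<close> by (auto simp: in_segment)
    have "F z \<le> (1 - u) * F x + u * F y"
      using convex_onD[OF convex_on_char_fun[OF cD, of r], of u x y] u that by (simp add: F_def)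
    moreover have "(1 - u) * F x \<le> 0" "u * F y < 0"
      using u that by (auto simp: mult_nonneg_nonpos mult_pos_neg)
    ultimately show ?thesis by linarith
  qed
  have neg: "F x < 0" if x: "\<eta>1 < x" "x < \<eta>2" for x
  proof (cases x m rule: linorder_cases)
    case less
    then have "x \<in> open_segment \<eta>1 m"
      using x by (simp add: open_segment_eq_real_ivl)
    with between[of \<eta>1 m x] \<eta>1 m Fm show ?thesis by simp
  next
    case greater
    then have "x \<in> open_segment \<eta>2 m"
      using x by (simp add: open_segment_eq_real_ivl)
    with between[of \<eta>2 m x] \<eta>2 m Fm show ?thesis by simp
  qed (use Fm in simp)
  \<comment> \<open>An earlier root \<open>x\<close> would place \<open>\<eta>1\<close> strictly
    between \<open>x\<close> and \<open>m\<close>, making \<open>F \<eta>1\<close> negative.\<close>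
  have nz: "F x \<noteq> 0" if x: "0 < x" "x < \<eta>1" for x
  proof
    assume "F x = 0"
    moreover have "\<eta>1 \<in> open_segment x m"
      using x \<eta>1 ne by (simp add: open_segment_eq_real_ivl)
    ultimately have "F \<eta>1 < 0"
      using between[of x m \<eta>1] x m Fm by simp
    then show False using \<eta>1 by simp
  qed
  have "next_root_after F 0 \<eta>1"
    using \<eta>1 ne nz by (simp add: next_root_after_def)
  moreover have "\<eta>1 < \<eta>2"
    using \<eta>1 \<eta>2 ne by linarith
  then have "next_root_after F \<eta>1 \<eta>2"
    using \<eta>2 neg by (auto simp: next_root_after_def dest: less_imp_neq)
  ultimately show ?thesis
    using neg unfolding F_def by (rule that)
qed

section \<open>The explicit ordered pair\<close>

lemma has_real_derivative_If:
  fixes g h :: "real \<Rightarrow> real"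
  assumes "x \<noteq> b"
    and g: "x < b \<Longrightarrow> (g has_real_derivative g') (at x)"
    and h: "b < x \<Longrightarrow> (h has_real_derivative h') (at x)"
  shows "((\<lambda>x. if x < b then g x else h x) has_real_derivative (if x < b then g' else h')) (at x)"
proof (cases "x < b")
  case True
  then show ?thesis
    using has_field_derivative_transform_within_open[OF g, of "{..<b}"] by auto
next
  case False
  then show ?thesis
    using has_field_derivative_transform_within_open[OF h, of "{b<..}"] assms(1) by auto
qed

text \<open>For negative arguments the linear part vanishes and the quadratic term has the right
  sign. For positive ones the second derivative changes sign; bounding the delayed value by 1 leaves
  \<open>1 - exp (- (\<eta> * r)) - 2 * D * \<eta>^2\<close> as factor, which is what
  \<open>small\<close> controls.\<close>

lemma supersolution_super_profile:
  assumes \<eta>: "\<eta> > 0" "char_fun c D r \<eta> = 0" and r: "r \<ge> 0"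
    and small: "1 - exp (- (\<eta> * r)) \<le> 2 * D * \<eta>^2"
  shows "supersolution_off c D r {0} (super_profile \<eta>)"
proof -
  define e where "e x = exp (\<eta> * x)" for x
  define e' where "e' x = exp (- (\<eta> * x))" for x
  have e: "(e has_real_derivative \<eta> * e x) (at x)" "(e' has_real_derivative - \<eta> * e' x) (at x)" for x
    unfolding e_def[abs_def] e'_def[abs_def] by (auto intro!: derivative_eq_intros)
  define f where "f x = (if x < 0 then 1/2 * e x else 1 - 1/2 * e' x)" for x
  define f1 where "f1 x = (if x < 0 then 1/2 * \<eta> * e x else 1/2 * \<eta> * e' x)" for x
  define f2 where "f2 x = (if x < 0 then 1/2 * \<eta>^2 * e x else - (1/2 * \<eta>^2 * e' x))" for x
  define f3 where "f3 x = (if x < 0 then 1/2 * \<eta>^3 * e x else 1/2 * \<eta>^3 * e' x)" for x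
  have f: "super_profile \<eta> = f"
    by (simp add: super_profile_def f_def e_def e'_def fun_eq_iff)
  have d1: "(f has_real_derivative f1 x) (at x)" if "x \<in> - {0}" for x
    unfolding f_def[abs_def] f1_def using that
    by (intro has_real_derivative_If) (auto intro!: derivative_eq_intros e)
  have d2: "(f1 has_real_derivative f2 x) (at x)" if "x \<in> - {0}" for x
    unfolding f1_def[abs_def] f2_def using that
    by (intro has_real_derivative_If)
      (auto intro!: derivative_eq_intros e simp: power2_eq_square)
  have d3: "(f2 has_real_derivative f3 x) (at x)" if "x \<in> - {0}" for x
    unfolding f2_def[abs_def] f3_def using that
    by (intro has_real_derivative_If)
      (auto intro!: derivative_eq_intros e simp: power2_eq_square power3_eq_cube)
  have p: "c * \<eta>^3 - c * \<eta> = - D * \<eta>^2 - exp (- (\<eta> * r))"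
    using \<eta>(2) by (simp add: char_fun_def)
  have S: "open (- {0 :: real})" by auto
  have lhs: "profile_lhs c D r f x = c * f3 x + D * f2 x - c * f1 x + f (x - r) * (1 - f x)"
    if "x \<in> - {0}" for x
    by (rule profile_derivatives(2)[OF S d1 d2 d3 that])
  have "profile_lhs c D r f x \<le> 0" if "x \<in> - {0}" for x
  proof (cases "x < 0")
    case True
    have fr: "f (x - r) = 1/2 * (exp (- (\<eta> * r)) * e x)"
      using True r by (simp add: f_def e_def algebra_simps flip: exp_add)
    have "profile_lhs c D r f x = 1/2 * e x * (c * \<eta>^3 - c * \<eta> + D * \<eta>^2 + exp (- (\<eta> * r)))
        - 1/4 * exp (- (\<eta> * r)) * (e x * e x)"
      unfolding lhs[OF that] fr using True
      by (simp add: f1_def f2_def f3_def f_def algebra_simps diff_divide_distrib)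
    then show ?thesis
      unfolding p by (simp add: e_def)
  next
    case False
    then have "x > 0" using that by simp
    have "e (x - r) \<le> 1" if "x < r"
      using \<eta>(1) that by (simp add: e_def mult_nonneg_nonpos)
    then have le: "f (x - r) \<le> 1"
      by (force simp: f_def e'_def)
    have "profile_lhs c D r f x = 1/2 * e' x * (c * \<eta>^3 - c * \<eta> - D * \<eta>^2 + f (x - r))"
      unfolding lhs[OF that] using \<open>x > 0\<close>
      by (simp add: f1_def f2_def f3_def f_def[of x] algebra_simps)
    also have "\<dots> \<le> 0"
      unfolding p using small le by (intro mult_nonneg_nonpos) (auto simp: e'_def)
    finally show ?thesis .
  qed
  then show ?thesis
    using profile_derivatives(1)[OF S d1 d2 d3] by (auto simp: supersolution_off_def f)
qed

section \<open>The explicit subsolution\<close>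

lemma C1_differentiable_on_If:
  fixes g g' :: "real \<Rightarrow> real"
  assumes g: "\<And>x. (g has_real_derivative g' x) (at x)"
    and cont: "continuous_on UNIV g'" and zero: "g' b = 0"
  shows "(\<lambda>x. if x < b then g x else g b) C1_differentiable_on UNIV"
proof -
  let ?f = "\<lambda>x. if x < b then g x else g b"
  have at_b: "(?f has_real_derivative 0) (at b)"
    unfolding has_field_derivative_iff filterlim_at_split
  proof
    have "((\<lambda>y. (g y - g b) / (y - b)) \<longlongrightarrow> 0) (at b)"
      using g[of b] zero by (simp add: has_field_derivative_iff)
    then have "((\<lambda>y. (g y - g b) / (y - b)) \<longlongrightarrow> 0) (at_left b)"
      by (simp add: filterlim_at_split)
    then show "((\<lambda>y. (?f y - ?f b) / (y - b)) \<longlongrightarrow> 0) (at_left b)"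
      by (rule Lim_transform_eventually) (auto simp: eventually_at_filter)
    show "((\<lambda>y. (?f y - ?f b) / (y - b)) \<longlongrightarrow> 0) (at_right b)"
      by (rule Lim_transform_eventually[OF tendsto_const]) (auto simp: eventually_at_filter)
  qed
  \<comment> \<open>Since \<open>g' b = 0\<close>, one formula with \<open>min x b\<close> covers
    both branches and the junction, and its continuity is inherited from \<open>g'\<close>.\<close>
  have deriv: "(?f has_real_derivative g' (min x b)) (at x)" for x
  proof (cases "x = b")
    case False
    have "(?f has_real_derivative (if x < b then g' x else 0)) (at x)"
      using False by (intro has_real_derivative_If g) auto
    then show ?thesis using zero False by (cases "x < b") (auto simp: min_def)
  qed (use at_b zero in simp)
  have "continuous_on UNIV (\<lambda>x. g' (min x b))"
    by (rule continuous_on_compose2[OF cont]) (auto intro!: continuous_intros)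
  with deriv show ?thesis
    unfolding C1_differentiable_on_def has_real_derivative_iff_has_vector_derivative
    by (intro exI[of _ "\<lambda>x. g' (min x b)"]) auto
qed

text \<open>\<open>smooth\<close> says that the left branch is stationary at \<open>\<xi>1\<close>,
  which is the condition for joining a constant with class C1. The bound
  \<open>\<epsilon> \<le> \<eta>\<close> lets the \<open>\<eta> + \<epsilon>\<close> term dominate
  quadratic terms on the negative axis.\<close>

locale sub_profile_parameters =
  fixes c D r \<eta> \<epsilon> q \<xi>1 :: real
  assumes r: "r \<ge> 0" and \<eta>: "\<eta> > 0" "char_fun c D r \<eta> = 0"
    and \<epsilon>: "0 < \<epsilon>" "\<epsilon> \<le> \<eta>" and \<xi>1: "\<xi>1 < 0"
    and q: "q > 0" "q * char_fun c D r (\<eta> + \<epsilon>) \<le> -1"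
    and smooth: "q * exp (\<epsilon> * \<xi>1) = \<eta> / (\<eta> + \<epsilon>)"
begin

definition \<kappa> where "\<kappa> = \<eta> + \<epsilon>"

definition g :: "nat \<Rightarrow> real \<Rightarrow> real"
  where "g n x = 1/2 * (\<eta>^n * exp (\<eta> * x) - q * \<kappa>^n * exp (\<kappa> * x))"

lemma g_deriv: "(g n has_real_derivative g (Suc n) x) (at x)"
  unfolding g_def[abs_def] by (auto intro!: derivative_eq_intros simp: algebra_simps)

lemma sub_profile_eq: "sub_profile \<eta> \<epsilon> q \<xi>1 = (\<lambda>x. if x < \<xi>1 then g 0 x else g 0 \<xi>1)"
  by (simp add: fun_eq_iff sub_profile_def sub_level_def g_def \<kappa>_def algebra_simps exp_add)

lemma g1_zero: "g 1 \<xi>1 = 0"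
proof -
  have "g 1 \<xi>1 = 1/2 * (\<eta> - (q * exp (\<epsilon> * \<xi>1)) * \<kappa>) * exp (\<eta> * \<xi>1)"
    by (simp add: g_def \<kappa>_def algebra_simps exp_add)
  then show ?thesis
    unfolding smooth using \<eta> \<epsilon> by (simp add: \<kappa>_def)
qed

lemma C1_sub_profile: "sub_profile \<eta> \<epsilon> q \<xi>1 C1_differentiable_on UNIV"
  unfolding sub_profile_eq
proof (rule C1_differentiable_on_If)
  show "(g 0 has_real_derivative g 1 x) (at x)" for x
    using g_deriv[of 0] by simp
  show "continuous_on UNIV (g 1)"
    unfolding g_def[abs_def] by (intro continuous_intros)
qed (rule g1_zero)

lemma sub_level_bounds:
  shows "sub_level \<eta> \<epsilon> q \<xi>1 = 1/2 * (\<epsilon> / (\<eta> + \<epsilon>)) * exp (\<eta> * \<xi>1)"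
    "0 < sub_level \<eta> \<epsilon> q \<xi>1" "sub_level \<eta> \<epsilon> q \<xi>1 < 1/2 * exp (\<eta> * \<xi>1)"
    "sub_level \<eta> \<epsilon> q \<xi>1 < 1/2"
proof -
  have "1 - \<eta> / (\<eta> + \<epsilon>) = \<epsilon> / (\<eta> + \<epsilon>)"
    using \<eta> \<epsilon> by (simp add: field_simps)
  then show eq: "sub_level \<eta> \<epsilon> q \<xi>1 = 1/2 * (\<epsilon> / (\<eta> + \<epsilon>)) * exp (\<eta> * \<xi>1)"
    by (simp add: sub_level_def smooth)
  show "0 < sub_level \<eta> \<epsilon> q \<xi>1"
    unfolding eq using \<eta> \<epsilon> by simp
  have "\<epsilon> / (\<eta> + \<epsilon>) < 1"
    using \<eta> \<epsilon> by simp
  then have "1/2 * (\<epsilon> / (\<eta> + \<epsilon>)) * exp (\<eta> * \<xi>1) < 1/2 * 1 * exp (\<eta> * \<xi>1)"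
    by (intro mult_strict_right_mono mult_strict_left_mono) auto
  then show *: "sub_level \<eta> \<epsilon> q \<xi>1 < 1/2 * exp (\<eta> * \<xi>1)"
    unfolding eq by (simp only: mult_1_right)
  have "exp (\<eta> * \<xi>1) < 1"
    using \<eta> \<xi>1 by (simp add: mult_pos_neg)
  with * show "sub_level \<eta> \<epsilon> q \<xi>1 < 1/2" by linarith
qed

lemma g0_bounds:
  assumes "x < \<xi>1"
  shows "0 \<le> g 0 x" "g 0 x \<le> 1/2 * exp (\<eta> * x)"
proof -
  have "q * exp (\<epsilon> * x) \<le> q * exp (\<epsilon> * \<xi>1)"
    using q \<epsilon> assms by simp
  also have "\<dots> \<le> 1"
    unfolding smooth using \<eta> \<epsilon> by simp
  finally have "0 \<le> 1/2 * (1 - q * exp (\<epsilon> * x)) * exp (\<eta> * x)" by simp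
  then show "0 \<le> g 0 x"
    by (simp add: g_def \<kappa>_def algebra_simps exp_add)
  show "g 0 x \<le> 1/2 * exp (\<eta> * x)"
    using q by (simp add: g_def)
qed

lemma sub_profile_nonneg: "0 \<le> sub_profile \<eta> \<epsilon> q \<xi>1 x"
  using g0_bounds(1)[of x] sub_level_bounds(2)
  by (auto simp: sub_profile_eq) (simp add: sub_profile_def sub_level_def g_def \<kappa>_def algebra_simps exp_add)

lemma sub_profile_le_super_profile:
  "sub_profile \<eta> \<epsilon> q \<xi>1 x \<le> super_profile \<eta> x"
proof (cases "x < \<xi>1")
  case True
  then show ?thesis
    using g0_bounds(2)[OF True] \<xi>1 by (simp add: sub_profile_eq super_profile_def)
next
  case False
  then have eq: "sub_profile \<eta> \<epsilon> q \<xi>1 x = sub_level \<eta> \<epsilon> q \<xi>1"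
    by (simp add: sub_profile_def)
  show ?thesis
  proof (cases "x < 0")
    case True
    have "exp (\<eta> * \<xi>1) \<le> exp (\<eta> * x)"
      using False \<eta> by simp
    with sub_level_bounds(3) have "sub_level \<eta> \<epsilon> q \<xi>1 \<le> 1/2 * exp (\<eta> * x)"
      by linarith
    with True show ?thesis
      by (simp add: eq super_profile_def)
  next
    case F: False
    have "exp (- (\<eta> * x)) \<le> 1"
      using F \<eta> by simp
    with sub_level_bounds(4) have "sub_level \<eta> \<epsilon> q \<xi>1 \<le> 1 - 1/2 * exp (- (\<eta> * x))"
      by linarith
    with F show ?thesis
      by (simp add: eq super_profile_def)
  qed
qed

text \<open>Left of \<open>\<xi>1\<close> the linear part is at least
  \<open>1/2 * exp (\<kappa> * x)\<close>, while the product lost is at most a quarter of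
  \<open>exp (2 * \<eta> * x)\<close>. Right of it all derivatives vanish and a nonnegative product
  remains.\<close>

lemma subsolution_sub_profile: "subsolution_off c D r {\<xi>1} (sub_profile \<eta> \<epsilon> q \<xi>1)"
proof -
  let ?f = "sub_profile \<eta> \<epsilon> q \<xi>1"
  define f where "f n x = (if x < \<xi>1 then g n x else 0)" for n x
  have d1: "(?f has_real_derivative f 1 x) (at x)" if "x \<in> - {\<xi>1}" for x
    unfolding sub_profile_eq f_def using that g_deriv[of 0]
    by (intro has_real_derivative_If) auto
  have d: "(f n has_real_derivative f (Suc n) x) (at x)" if "x \<in> - {\<xi>1}" for n x
    unfolding f_def[abs_def] using that g_deriv
    by (intro has_real_derivative_If) auto
  have d2: "(f 1 has_real_derivative f 2 x) (at x)" if "x \<in> - {\<xi>1}" for x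
    using d[OF that, of 1] by (simp add: numeral_2_eq_2)
  have d3: "(f 2 has_real_derivative f 3 x) (at x)" if "x \<in> - {\<xi>1}" for x
    using d[OF that, of 2] by (simp add: numeral_2_eq_2 numeral_3_eq_3)
  have S: "open (- {\<xi>1})" by auto
  have lhs: "profile_lhs c D r ?f x = c * f 3 x + D * f 2 x - c * f 1 x + ?f (x - r) * (1 - ?f x)"
    if "x \<in> - {\<xi>1}" for x
    by (rule profile_derivatives(2)[OF S d1 d2 d3 that])
  have "0 \<le> profile_lhs c D r ?f x" if x: "x \<in> - {\<xi>1}" for x
  proof (cases "x < \<xi>1")
    case True
    then have xr: "x - r < \<xi>1" using r by simp
    let ?E = "exp (\<eta> * x)" and ?K = "exp (\<kappa> * x)"
    have gr: "g 0 (x - r) = 1/2 * (exp (- (\<eta> * r)) * ?E - q * exp (- (\<kappa> * r)) * ?K)"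
      by (simp add: g_def algebra_simps flip: exp_add)
    have "profile_lhs c D r ?f x
        = c * g 3 x + D * g 2 x - c * g 1 x + g 0 (x - r) - g 0 (x - r) * g 0 x"
      unfolding lhs[OF x] using True xr
      by (simp add: f_def sub_profile_eq algebra_simps)
    moreover have "c * g 3 x + D * g 2 x - c * g 1 x + g 0 (x - r)
        = 1/2 * char_fun c D r \<eta> * ?E + - (1/2) * (q * char_fun c D r \<kappa>) * ?K"
      unfolding gr by (simp add: g_def char_fun_def algebra_simps)
    moreover have "1/2 * ?K \<le> 1/2 * char_fun c D r \<eta> * ?E + - (1/2) * (q * char_fun c D r \<kappa>) * ?K"
      using mult_right_mono[OF q(2)[folded \<kappa>_def], of ?K] by (simp add: \<eta>)
    ultimately have "profile_lhs c D r ?f x \<ge> 1/2 * ?K - g 0 (x - r) * g 0 x"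
      by linarith
    moreover have "g 0 (x - r) * g 0 x \<le> (1/2 * ?E) * (1/2 * ?E)"
    proof (intro mult_mono)
      have "exp (\<eta> * (x - r)) \<le> ?E" using r \<eta> by simp
      then show "g 0 (x - r) \<le> 1/2 * ?E"
        using g0_bounds(2)[OF xr] by linarith
    qed (use g0_bounds[OF True] g0_bounds[OF xr] in auto)
    moreover have "?E * ?E \<le> ?K"
    proof -
      have "?E * ?E = exp ((2 * \<eta>) * x)" by (simp flip: exp_add)
      also have "\<dots> \<le> ?K"
        using \<epsilon> True \<xi>1 by (simp add: \<kappa>_def mult_right_mono_neg)
      finally show ?thesis .
    qed
    moreover have "?K > 0" by simp
    ultimately show ?thesis by linarith
  next
    case False
    have "?f x = sub_level \<eta> \<epsilon> q \<xi>1"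
      using False by (simp add: sub_profile_def)
    then have "profile_lhs c D r ?f x = ?f (x - r) * (1 - sub_level \<eta> \<epsilon> q \<xi>1)"
      unfolding lhs[OF x] using False by (simp add: f_def)
    then show ?thesis
      using sub_profile_nonneg sub_level_bounds(4) by simp
  qed
  then show ?thesis
    using profile_derivatives(1)[OF S d1 d2 d3] by (auto simp: subsolution_off_def)
qed

end

section \<open>Admissible delays, choice of parameters and assembly of the results\<close>

theorem corollary4p7:
  fixes c D :: real
  assumes "c > 0" and "D > 0"
    and "\<exists>l1 l2. 0 < l1 \<and> l1 < l2 \<and> char_fun c D 0 l1 = 0 \<and> char_fun c D 0 l2 = 0"
  shows "\<exists>r0>0. \<forall>r. 0 \<le> r \<and> r < r0 \<longrightarrow>
    (\<exists>\<eta>1 \<eta>2.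
       next_root_after (char_fun c D r) 0 \<eta>1 \<and>
       next_root_after (char_fun c D r) \<eta>1 \<eta>2 \<and>
       (\<exists>\<epsilon> q \<xi>1. \<epsilon> > 0 \<and> \<eta>1 + \<epsilon> < \<eta>2 \<and> q > 0 \<and> \<xi>1 < 0 \<and>
          0 < sub_level \<eta>1 \<epsilon> q \<xi>1 \<and> sub_level \<eta>1 \<epsilon> q \<xi>1 < 1 \<and>
          sub_profile \<eta>1 \<epsilon> q \<xi>1 C1_differentiable_on UNIV \<and>
          supersolution_off c D r {0} (super_profile \<eta>1) \<and>
          subsolution_off c D r {\<xi>1} (sub_profile \<eta>1 \<epsilon> q \<xi>1) \<and>
          (\<forall>\<xi>. 0 \<le> sub_profile \<eta>1 \<epsilon> q \<xi>1 \<xi> \<and>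
               sub_profile \<eta>1 \<epsilon> q \<xi>1 \<xi> \<le> super_profile \<eta>1 \<xi>))) \<and>
    (\<exists>\<phi>. monotone_wave c D r \<phi>)"
proof -
  obtain l1 l2 where l: "0 < l1" "l1 < l2" "char_fun c D 0 l1 = 0" "char_fun c D 0 l2 = 0"
    using assms(3) by blast
  define m h where "m = (l1 + l2) / 2" and "h = (l2 - l1) / 2"
  have mh: "l1 = m - h" "l2 = m + h" "0 < m" "0 < h"
    using l(1,2) by (auto simp: m_def h_def field_simps)
  \<comment> \<open>Without delay the exponential is constant, so the midpoint value is the mean of
    the end values minus an explicit positive second difference of the cubic.\<close>
  have "char_fun c D 0 m = (char_fun c D 0 (m - h) + char_fun c D 0 (m + h)) / 2
      - (3 * c * m * h^2 + D * h^2)"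
    by (simp add: char_fun_def field_simps power2_eq_square power3_eq_cube)
  also have "\<dots> < 0"
  proof -
    have "0 < 3 * c * m * h^2 + D * h^2"
      using mh assms(1,2) by (intro add_pos_pos) auto
    then show ?thesis using l(3,4) by (simp add: mh)
  qed
  finally have m: "char_fun c D 0 m < 0" .
  obtain \<mu> a b where "factored_operator c D \<mu> a b"
    using factored_operator_exists[OF assms(1,2) l(1)] l(3) by (auto simp: char_fun_def)
  then interpret factored_operator c D \<mu> a b .
  \<comment> \<open>\<open>r < 1\<close> yields a lower bound for \<open>\<eta>1\<close> that is
    uniform in \<open>r\<close>; \<open>r < 2 * D / (c + 1)\<close> then gives the smallness
    condition of the supersolution.\<close>
  define r0 where "r0 = min 1 (2 * D / (c + 1))"
  show ?thesis
  proof (rule exI[of _ r0], intro conjI allI impI)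
    show "r0 > 0" using assms(1,2) by (simp add: r0_def)
    fix r assume "0 \<le> r \<and> r < r0"
    then have r: "0 \<le> r" "r < 1" "r < 2 * D / (c + 1)"
      by (auto simp: r0_def)
    \<comment> \<open>The exponential decreases in \<open>r\<close>, so negativity at
      \<open>m\<close> persists for every nonnegative delay.\<close>
    have "char_fun c D r m \<le> char_fun c D 0 m"
      using r mh by (simp add: char_fun_def)
    then have "char_fun c D r m < 0" using m by simp
    from char_fun_next_roots[OF assms(1,2) mh(3) this]
    obtain \<eta>1 \<eta>2 where roots: "next_root_after (char_fun c D r) 0 \<eta>1"
        "next_root_after (char_fun c D r) \<eta>1 \<eta>2"
      and neg: "\<And>x. \<eta>1 < x \<Longrightarrow> x < \<eta>2 \<Longrightarrow> char_fun c D r x < 0"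
      by blast
    have \<eta>: "\<eta>1 > 0" "char_fun c D r \<eta>1 = 0" "\<eta>1 < \<eta>2"
      using roots by (auto simp: next_root_after_def)
    \<comment> \<open>The two entries ensure \<open>\<eta>1 + \<epsilon> \<le> 2 * \<eta>1\<close>
      and \<open>\<eta>1 + \<epsilon> < \<eta>2\<close>.\<close>
    define \<epsilon> where "\<epsilon> = min \<eta>1 ((\<eta>2 - \<eta>1) / 2)"
    have \<epsilon>: "0 < \<epsilon>" "\<epsilon> \<le> \<eta>1" "\<eta>1 + \<epsilon> < \<eta>2"
      using \<eta> by (auto simp: \<epsilon>_def min_def field_simps)
    define N where "N = - char_fun c D r (\<eta>1 + \<epsilon>)"
    have N: "N > 0" using neg[of "\<eta>1 + \<epsilon>"] \<epsilon> by (simp add: N_def)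
    define q where "q = max 1 (1 / N)"
    have q: "q \<ge> 1" "q * N \<ge> 1"
      using N mult_right_mono[of "1 / N" q N] by (auto simp: q_def)
    \<comment> \<open>The solution of the stationarity equation \<open>smooth\<close>;
      \<open>q \<ge> 1\<close> makes it negative.\<close>
    define \<xi>1 where "\<xi>1 = ln (\<eta>1 / (q * (\<eta>1 + \<epsilon>))) / \<epsilon>"
    have pos_arg: "0 < \<eta>1 / (q * (\<eta>1 + \<epsilon>))"
      using \<eta> \<epsilon> q by simp
    have "1 * \<eta>1 < q * (\<eta>1 + \<epsilon>)"
      using \<eta> \<epsilon> q by (intro mult_le_less_imp_less) auto
    then have "\<eta>1 / (q * (\<eta>1 + \<epsilon>)) < 1"
      using \<eta> by (simp add: divide_less_eq)
    then have \<xi>1: "\<xi>1 < 0"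
      using pos_arg \<epsilon> by (simp add: \<xi>1_def divide_neg_pos)
    have smooth: "q * exp (\<epsilon> * \<xi>1) = \<eta>1 / (\<eta>1 + \<epsilon>)"
      using \<epsilon> q pos_arg by (simp add: \<xi>1_def)
    interpret sub: sub_profile_parameters c D r \<eta>1 \<epsilon> q \<xi>1
      using r \<eta> \<epsilon> q \<xi>1 smooth by unfold_locales (auto simp: N_def)
    have super: "supersolution_off c D r {0} (super_profile \<eta>1)"
    proof (rule supersolution_super_profile[OF \<eta>(1,2) r(1)])
      \<comment> \<open>The characteristic equation forces
        \<open>exp (- (\<eta>1 * r)) < c * \<eta>1\<close>. With this tangent bound and
        \<open>r < 1\<close> it follows that \<open>1 \<le> \<eta>1 * (c + 1)\<close>, hence
        \<open>r \<le> 2 * D * \<eta>1\<close>.\<close>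
      have e: "1 - \<eta>1 * r \<le> exp (- (\<eta>1 * r))"
        using exp_ge_add_one_self[of "- (\<eta>1 * r)"] by simp
      have "c * \<eta>1^3 + D * \<eta>1^2 > 0"
        using assms(1,2) \<eta> by (simp add: add_pos_pos)
      then have "1 - \<eta>1 * r < c * \<eta>1"
        using e \<eta>(2) unfolding char_fun_def by linarith
      moreover have "\<eta>1 * r \<le> \<eta>1 * 1"
        using r \<eta> by (intro mult_left_mono) auto
      ultimately have "1 \<le> \<eta>1 * (c + 1)"
        by (simp add: algebra_simps)
      have "r * 1 \<le> r * (\<eta>1 * (c + 1))"
        using r \<open>1 \<le> \<eta>1 * (c + 1)\<close> by (intro mult_left_mono) auto
      also have "\<dots> = \<eta>1 * (r * (c + 1))" by simp
      also have "\<dots> \<le> \<eta>1 * (2 * D)"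
        using r(3) assms(1) \<eta>(1) by (intro mult_left_mono) (auto simp: less_divide_eq)
      finally have "\<eta>1 * r \<le> \<eta>1 * (\<eta>1 * (2 * D))"
        using \<eta>(1) by (intro mult_left_mono) auto
      with e show "1 - exp (- (\<eta>1 * r)) \<le> 2 * D * \<eta>1^2"
        by (simp add: power2_eq_square algebra_simps)
    qed
    have "sub_level \<eta>1 \<epsilon> q \<xi>1 < 1" "q > 0"
      using sub.sub_level_bounds(4) q by simp_all
    with roots \<epsilon> \<xi>1 super sub.sub_level_bounds(2) sub.C1_sub_profile
      sub.subsolution_sub_profile sub.sub_profile_nonneg sub.sub_profile_le_super_profile
    show "\<exists>\<eta>1 \<eta>2.
       next_root_after (char_fun c D r) 0 \<eta>1 \<and>
       next_root_after (char_fun c D r) \<eta>1 \<eta>2 \<and>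
       (\<exists>\<epsilon> q \<xi>1. \<epsilon> > 0 \<and> \<eta>1 + \<epsilon> < \<eta>2 \<and> q > 0 \<and> \<xi>1 < 0 \<and>
          0 < sub_level \<eta>1 \<epsilon> q \<xi>1 \<and> sub_level \<eta>1 \<epsilon> q \<xi>1 < 1 \<and>
          sub_profile \<eta>1 \<epsilon> q \<xi>1 C1_differentiable_on UNIV \<and>
          supersolution_off c D r {0} (super_profile \<eta>1) \<and>
          subsolution_off c D r {\<xi>1} (sub_profile \<eta>1 \<epsilon> q \<xi>1) \<and>
          (\<forall>\<xi>. 0 \<le> sub_profile \<eta>1 \<epsilon> q \<xi>1 \<xi> \<and>
               sub_profile \<eta>1 \<epsilon> q \<xi>1 \<xi> \<le> super_profile \<eta>1 \<xi>))"
      by blast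
    show "\<exists>\<phi>. monotone_wave c D r \<phi>"
      using monotone_wave_exists[OF r(1) \<eta>(1,2), of "\<eta>1 + \<epsilon>"] \<epsilon> neg[of "\<eta>1 + \<epsilon>"] by simp
  qed
qed

end
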